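(* Let $D$ be a delta-matroid on $[n,\overline{n}]$ which has an enveloping matroid. Write $U_D(u,0)=a_n+a_{n-1}u+\dots+a_0u^n$. Then for every $k\in\{1,\dots,n-1\}$, $$a_k^2\ge\frac{2n-k+1}{2n-k}\cdot\frac{k+1}{k}\,a_{k+1}a_{k-1}.$$
   Context: Let $[n,\overline{n}]=\{1,\dots,n,\overline{1},\dots,\overline{n}\}$ with involution $a\mapsto\overline{a}$; $\overline{S}=\{\overline{a}:a\in S\}$. A subset of $[n,\overline{n}]$ is admissible if it contains at most one of $i,\overline{i}$ for each $i$; $\operatorname{AdS}_n$ is the set of admissible subsets. In $\mathbb{R}^n$ set $e_{\overline{i}}=-e_i$, $e_S=\sum_{a\in S}e_a$. A delta-matroid $D$ on $[n,\overline{n}]$ is a nonempty collection $\mathcal{F}$ of admissible sets of size $n$ (feasible sets) such that $P(D)=\operatorname{Conv}\{e_B:B\in\mathcal{F}\}$ has all edges parallel to some $e_i$ or $e_i\pm e_j$. Its rank function is $g_D(S)=\max_{B\in\mathcal{F}}(|S\cap B|-|\overline{S}\cap B|)$ for $S\in\operatorname{AdS}_n$. The $U$-polynomial is $U_D(u,v)=\sum_{S\in\operatorname{AdS}_n}u^{n-|S|}v^{(|S|-g_D(S))/2}$ (a polynomial; at $v=0$ the terms with $g_D(S)=|S|$ contribute $u^{n-|S|}$). For $S\subseteq[n,\overline{n}]$ let $u_S\in\mathbb{R}^{[n,\overline{n}]}$ be its indicator vector; for a matroid $M$ on the $2n$-element ground set $[n,\overline{n}]$ let $P(M)=\operatorname{Conv}\{u_B:B\text{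 a basis of }M\}$. Let $\operatorname{env}\colon\mathbb{R}^{[n,\overline{n}]}\to\mathbb{R}^n$ be $(x_1,\dots,x_n,x_{\overline{1}},\dots,x_{\overline{n}})\mapsto(x_1-x_{\overline{1}},\dots,x_n-x_{\overline{n}})$. A matroid $M$ on $[n,\overline{n}]$ is an enveloping matroid for $D$ if $\operatorname{env}(P(M))=P(D)$. *)

theory Defs
  imports "HOL-Analysis.Analysis"
begin

text \<open>Ground set [n, n-bar] is modelled as the finite type 'n \<times> bool, with n = CARD('n):
  (i, False) stands for i and (i, True) for i-bar.  R^n is real^'n.\<close>

definition bar :: "'n \<times> bool \<Rightarrow> 'n \<times> bool" where
  "bar a = (fst a, \<not> snd a)"

definition bar_set :: "('n \<times> bool) set \<Rightarrow> ('n \<times> bool) set" where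
  "bar_set S = bar ` S"

definition admissible :: "('n \<times> bool) set \<Rightarrow> bool" where
  "admissible S \<longleftrightarrow> (\<forall>a\<in>S. bar a \<notin> S)"

definition AdS :: "('n::finite \<times> bool) set set" where
  "AdS = {S. admissible S}"

definition evec :: "'n \<times> bool \<Rightarrow> real ^ 'n" where
  "evec a = (if snd a then - axis (fst a) 1 else axis (fst a) 1)"

definition eset :: "('n::finite \<times> bool) set \<Rightarrow> real ^ 'n" where
  "eset S = (\<Sum>a\<in>S. evec a)"

definition dm_polytope :: "('n::finite \<times> bool) set set \<Rightarrow> (real ^ 'n) set" where
  "dm_polytope F = convex hull (eset ` F)"

definition edge_dirs :: "(real ^ 'n) set" where
  "edge_dirs = {axis i 1 | i. True} \<union> {axis i 1 + axis j 1 | i j. i \<noteq> j}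
              \<union> {axis i 1 - axis j 1 | i j. i \<noteq> j}"

definition delta_matroid :: "('n::finite \<times> bool) set set \<Rightarrow> bool" where
  "delta_matroid F \<longleftrightarrow>
     F \<noteq> {} \<and> (\<forall>B\<in>F. admissible B \<and> card B = CARD('n)) \<and>
     (\<forall>E. E face_of dm_polytope F \<and> aff_dim E = 1 \<longrightarrow>
        (\<forall>x\<in>E. \<forall>y\<in>E. \<exists>c d. d \<in> edge_dirs \<and> y - x = c *\<^sub>R d))"

definition dm_rank :: "('n \<times> bool) set set \<Rightarrow> ('n \<times> bool) set \<Rightarrow> int" where
  "dm_rank F S = (MAX B\<in>F. int (card (S \<inter> B)) - int (card (bar_set S \<inter> B)))"

definition U_poly :: "('n::finite \<times> bool) set set \<Rightarrow> real \<Rightarrow> real \<Rightarrow> real" where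
  "U_poly F u v = (\<Sum>S\<in>AdS. u ^ (CARD('n) - card S) *
       v ^ nat ((int (card S) - dm_rank F S) div 2))"

definition matroid_bases :: "'a::finite set set \<Rightarrow> bool" where
  "matroid_bases \<B> \<longleftrightarrow> \<B> \<noteq> {} \<and>
     (\<forall>B1\<in>\<B>. \<forall>B2\<in>\<B>. \<forall>x\<in>B1 - B2. \<exists>y\<in>B2 - B1. insert y (B1 - {x}) \<in> \<B>)"

definition ind_vec :: "('n::finite \<times> bool) set \<Rightarrow> real ^ ('n \<times> bool)" where
  "ind_vec S = (\<chi> a. if a \<in> S then 1 else 0)"

definition matroid_polytope :: "('n::finite \<times> bool) set set \<Rightarrow> (real ^ ('n \<times> bool)) set" where
  "matroid_polytope \<B> = convex hull (ind_vec ` \<B>)"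

definition env :: "real ^ ('n::finite \<times> bool) \<Rightarrow> real ^ 'n" where
  "env x = (\<chi> i. x $ (i, False) - x $ (i, True))"

definition enveloping_matroid :: "('n::finite \<times> bool) set set \<Rightarrow> ('n \<times> bool) set set \<Rightarrow> bool" where
  "enveloping_matroid F \<B> \<longleftrightarrow> matroid_bases \<B> \<and> env ` matroid_polytope \<B> = dm_polytope F"

end

theory Submission
  imports Defs
begin

text \<open>
  Let \<open>M\<close> be an enveloping matroid.  An admissible set is contained in a feasible set iff it is
  independent in \<open>M\<close>, so \<open>a_k\<close> counts the independent sets of size \<open>k\<close> that meet every pair
  \<open>{i, bar i}\<close> at most once.  With \<open>N = 2n\<close>, the polynomial \<open>\<Sum> x^I y^(N - |I|)\<close> over the
  independent sets \<open>I\<close> of \<open>M\<close> is Lorentzian (the strong form of Mason's conjecture).  Killing all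
  multiples of \<open>x_i x_(bar i)\<close> and identifying \<open>x_i\<close> with \<open>x_(bar i)\<close> keeps it
  Lorentzian: on the level of second derivatives one subtracts a positive semidefinite diagonal form
  from a pulled back hyperbolic form.  Setting all remaining variables equal leaves a bivariate
  Lorentzian polynomial of degree \<open>2n\<close> with coefficients \<open>a_k\<close>, which is ultra log-concave.
  Lorentzian polynomials are handled through the local-to-global principle of Anari, Liu, Oveis
  Gharan and Vinzant: if all coordinate derivatives have a hyperbolic Hessian, then so have all
  derivatives in nonnegative directions.
\<close>

section \<open>Derivatives of weights on subsets\<close>

text \<open>A weight \<open>w\<close> stands for the homogeneous polynomial
  \<open>\<Sum>\<^sub>S w(S) x^S y^(d - |S|) / (d - |S|)!\<close> of any degree \<open>d\<close>; the index \<open>None\<close> belongs to the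
  variable \<open>y\<close>, whose derivative therefore fixes \<open>w\<close>.\<close>

definition coord_deriv :: "'a option \<Rightarrow> ('a set \<Rightarrow> real) \<Rightarrow> 'a set \<Rightarrow> real" where
  "coord_deriv i w S = (case i of None \<Rightarrow> w S | Some a \<Rightarrow> if a \<in> S then 0 else w (insert a S))"

definition dir_deriv :: "('a::finite option \<Rightarrow> real) \<Rightarrow> ('a set \<Rightarrow> real) \<Rightarrow> 'a set \<Rightarrow> real" where
  "dir_deriv u w S = (\<Sum>i\<in>UNIV. u i * coord_deriv i w S)"

text \<open>Reverse Cauchy-Schwarz for the Hessian of every square-free coordinate derivative: the form has
  at most one positive eigenvalue.\<close>

definition hyperbolic :: "('a::finite set \<Rightarrow> real) \<Rightarrow> bool" where
  "hyperbolic w \<longleftrightarrow> (\<forall>J x p. (\<forall>i. 0 \<le> p i) \<longrightarrow>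
     dir_deriv x (dir_deriv x w) J * dir_deriv p (dir_deriv p w) J \<le> (dir_deriv x (dir_deriv p w) J)\<^sup>2)"

text \<open>The support is closed under subsets. This supplies the connectivity needed for the
  local-to-global step: a variable either has vanishing derivative, and then all further derivatives
  vanish too, or it is coupled to the variable of index \<open>None\<close>.\<close>

definition hereditary :: "('a set \<Rightarrow> real) \<Rightarrow> bool" where
  "hereditary w \<longleftrightarrow> (\<forall>S. 0 \<le> w S) \<and> (\<forall>S a. w S = 0 \<longrightarrow> w (insert a S) = 0)"

lemma coord_deriv_commute: "coord_deriv i (coord_deriv j w) = coord_deriv j (coord_deriv i w)"
  by (auto simp: coord_deriv_def fun_eq_iff insert_commute split: option.splits)

lemma coord_deriv_None [simp]: "coord_deriv None w = w"
  by (simp add: coord_deriv_def fun_eq_iff)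

lemma coord_deriv_dir_deriv: "coord_deriv i (dir_deriv u w) = dir_deriv u (coord_deriv i w)"
proof (rule ext)
  fix S
  have "dir_deriv u (coord_deriv i w) S = (\<Sum>k\<in>UNIV. u k * coord_deriv i (coord_deriv k w) S)"
    by (simp add: dir_deriv_def coord_deriv_commute)
  also have "\<dots> = coord_deriv i (dir_deriv u w) S"
    by (cases i) (auto simp: coord_deriv_def dir_deriv_def)
  finally show "coord_deriv i (dir_deriv u w) S = dir_deriv u (coord_deriv i w) S" by simp
qed

lemma dir_deriv_commute: "dir_deriv x (dir_deriv z w) = dir_deriv z (dir_deriv x w)"
proof (rule ext)
  fix S
  have *: "dir_deriv x (dir_deriv z w) S = (\<Sum>i\<in>UNIV. \<Sum>j\<in>UNIV. x i * z j * coord_deriv j (coord_deriv i w) S)" for x z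
    by (subst dir_deriv_def) (simp add: coord_deriv_dir_deriv dir_deriv_def sum_distrib_left mult.assoc)
  have "dir_deriv x (dir_deriv z w) S = (\<Sum>i\<in>UNIV. \<Sum>j\<in>UNIV. z j * x i * coord_deriv i (coord_deriv j w) S)"
    by (simp add: * coord_deriv_commute mult.commute)
  also have "\<dots> = dir_deriv z (dir_deriv x w) S"
    unfolding * by (rule sum.swap)
  finally show "dir_deriv x (dir_deriv z w) S = dir_deriv z (dir_deriv x w) S" .
qed

lemma dir_deriv_dir_deriv_eq: "dir_deriv x (dir_deriv z w) S = (\<Sum>i\<in>UNIV. \<Sum>j\<in>UNIV. x i * z j * coord_deriv i (coord_deriv j w) S)"
  by (subst dir_deriv_def) (simp add: coord_deriv_dir_deriv dir_deriv_def sum_distrib_left mult.assoc coord_deriv_commute)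

lemma dir_deriv_add_left: "dir_deriv (\<lambda>i. x i + c * y i) w = (\<lambda>S. dir_deriv x w S + c * dir_deriv y w S)"
  by (rule ext) (simp add: dir_deriv_def sum.distrib sum_distrib_left algebra_simps)

lemma dir_deriv_add_right: "dir_deriv x (\<lambda>S. f S + c * g S) = (\<lambda>S. dir_deriv x f S + c * dir_deriv x g S)"
proof
  fix S
  have "coord_deriv i (\<lambda>S. f S + c * g S) S = coord_deriv i f S + c * coord_deriv i g S" for i
    by (auto simp: coord_deriv_def split: option.splits)
  then show "dir_deriv x (\<lambda>S. f S + c * g S) S = dir_deriv x f S + c * dir_deriv x g S"
    by (simp add: dir_deriv_def sum.distrib sum_distrib_left algebra_simps)
qed

lemma coord_deriv_nonneg: "hereditary w \<Longrightarrow> 0 \<le> coord_deriv i w S"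
  by (auto simp: hereditary_def coord_deriv_def split: option.splits)

lemma hereditary_coord_deriv: "hereditary w \<Longrightarrow> hereditary (coord_deriv i w)"
  by (auto simp: hereditary_def coord_deriv_def insert_commute split: option.splits)

lemma coord_deriv_eq_0: "hereditary w \<Longrightarrow> w S = 0 \<Longrightarrow> coord_deriv i w S = 0"
  by (auto simp: hereditary_def coord_deriv_def split: option.splits)

lemma hereditary_dir_deriv:
  assumes "hereditary w" "\<And>i. 0 \<le> u i"
  shows "hereditary (dir_deriv u w)"
proof -
  have "dir_deriv u w (insert a S) = 0" if "dir_deriv u w S = 0" for a S
  proof -
    have z: "u i * coord_deriv i w S = 0" for i
    proof -
      have "\<forall>i\<in>UNIV. u i * coord_deriv i w S = 0"
        using that assms(2) coord_deriv_nonneg[OF assms(1)] unfolding dir_deriv_def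
        by (subst sum_nonneg_eq_0_iff[symmetric]) auto
      then show ?thesis by simp
    qed
    have "u i * coord_deriv i w (insert a S) = 0" for i
    proof (cases "u i = 0")
      case False
      then have "coord_deriv i w S = 0" using z[of i] by simp
      then show ?thesis using assms(1)
        by (auto simp: hereditary_def coord_deriv_def insert_commute split: option.splits if_splits)
    qed simp
    then show ?thesis unfolding dir_deriv_def by (intro sum.neutral) blast
  qed
  moreover have "0 \<le> dir_deriv u w S" for S
    unfolding dir_deriv_def using assms coord_deriv_nonneg[OF assms(1)] by (intro sum_nonneg) auto
  ultimately show ?thesis by (simp add: hereditary_def)
qed

section \<open>Inequalities for semidefinite and hyperbolic forms\<close>

lemma quadratic_nonneg_discriminant:
  fixes a b c :: real
  assumes "\<And>t. 0 \<le> a + 2 * b * t + c * t\<^sup>2" and "0 \<le> c"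
  shows "b\<^sup>2 \<le> a * c"
proof (cases "c = 0")
  case True
  have "b = 0"
  proof (rule ccontr)
    assume "b \<noteq> 0"
    \<comment> \<open>At this \<open>t\<close> the remaining linear function takes the value
      -1.\<close>
    then show False using assms(1)[of "- (a + 1) / (2 * b)"] True by (simp add: field_simps)
  qed
  then show ?thesis using True by simp
next
  case False
  then have "c > 0" using assms(2) by simp
  then show ?thesis using assms(1)[of "-b / c"]
    by (simp add: power2_eq_square field_simps)
qed

text \<open>Subtracting a semidefinite form from a hyperbolic one: \<open>a\<close>,
  \<open>c\<close>, \<open>b\<close> are the values of the hyperbolic form at (x,x), (x,p), (p,p),
  and \<open>e\<close>, \<open>g\<close>, \<open>f\<close> those of the semidefinite form. The
  condition \<open>f \<le> b\<close> says that the difference is still nonnegative at p. In the case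
  \<open>e < a\<close> the claim reduces to the inequality of arithmetic and geometric means for
  \<open>a * f\<close> and \<open>b * e\<close>.\<close>

lemma reverse_cauchy_diff:
  fixes a b c e f g :: real
  assumes "a * b \<le> c\<^sup>2" "g\<^sup>2 \<le> e * f" "0 \<le> e" "0 \<le> f" "f \<le> b"
  shows "(a - e) * (b - f) \<le> (c - g)\<^sup>2"
proof (cases "a \<le> e")
  case True
  then have "(a - e) * (b - f) \<le> 0" using assms by (simp add: mult_nonpos_nonneg)
  then show ?thesis by (smt (verit) zero_le_power2)
next
  case False
  then have ae: "e < a" by simp
  have c: "sqrt a * sqrt b \<le> \<bar>c\<bar>"
    using assms ae by (metis real_sqrt_abs real_sqrt_le_mono real_sqrt_mult)
  have g: "\<bar>g\<bar> \<le> sqrt e * sqrt f"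
    using assms by (metis real_sqrt_abs real_sqrt_le_mono real_sqrt_mult)
  have le: "sqrt e * sqrt f \<le> sqrt a * sqrt b"
    using assms ae by (intro mult_mono) auto
  have "(a - e) * (b - f) \<le> (sqrt a * sqrt b - sqrt e * sqrt f)\<^sup>2"
  proof -
    have sq: "(sqrt a)\<^sup>2 = a" "(sqrt b)\<^sup>2 = b" "(sqrt e)\<^sup>2 = e" "(sqrt f)\<^sup>2 = f"
      using assms ae by auto
    have "0 \<le> (sqrt a * sqrt f - sqrt b * sqrt e)\<^sup>2" by (rule zero_le_power2)
    also have "\<dots> = a * f + b * e - 2 * (sqrt a * sqrt b) * (sqrt e * sqrt f)"
      by (simp add: power2_diff power_mult_distrib sq)
    finally have "(a - e) * (b - f) \<le> a * b + e * f - 2 * (sqrt a * sqrt b) * (sqrt e * sqrt f)"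
      by (simp add: algebra_simps)
    also have "\<dots> = (sqrt a * sqrt b - sqrt e * sqrt f)\<^sup>2"
      by (simp add: power2_diff power_mult_distrib sq)
    finally show ?thesis .
  qed
  also have "\<dots> \<le> \<bar>c - g\<bar>\<^sup>2"
    using c g le by (intro power_mono) auto
  finally show ?thesis by simp
qed

section \<open>The local-to-global step\<close>

text \<open>The matrix \<open>A\<close>, which is \<open>H\<close> with normalised rows, is
  self-adjoint for \<open>ip\<close>, fixes \<open>u\<close> and satisfies
  \<open>ip (A x) y = B x y\<close>. The hypothesis \<open>main\<close> says that its eigenvalues
  are nonpositive or at least 1. On the hyperplane orthogonal to \<open>u\<close> they stay below 1,
  because \<open>r\<close> is joined to every vertex, so there they are nonpositive. Rayleigh
  quotients stand in for eigenvalues throughout.\<close>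

lemma star_negative_semidefinite:
  fixes H :: "'k \<Rightarrow> 'k \<Rightarrow> real" and u :: "'k \<Rightarrow> real" and K :: "'k set"
  defines "B \<equiv> \<lambda>x y. \<Sum>k\<in>K. (\<Sum>j\<in>K. H k j * x j) * y k"
  assumes fin: "finite K" and r: "r \<in> K"
    and sym: "\<And>i j. H i j = H j i" and nonneg: "\<And>i j. 0 \<le> H i j"
    and star: "\<And>k. k \<in> K \<Longrightarrow> 0 < H r k"
    and u: "\<And>k. k \<in> K \<Longrightarrow> 0 < u k"
    and main: "\<And>x. B x x \<le> (\<Sum>k\<in>K. u k * (\<Sum>j\<in>K. H k j * x j)\<^sup>2 / (\<Sum>j\<in>K. H k j * u j))"
    and orth: "B x u = 0"
  shows "B x x \<le> 0"
proof -
  define \<beta> where "\<beta> = (\<lambda>x k. \<Sum>j\<in>K. H k j * x j)"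
  define \<delta> where "\<delta> = \<beta> u"
  define ip where "ip = (\<lambda>x y. \<Sum>k\<in>K. \<delta> k / u k * x k * y k)"
  define A where "A = (\<lambda>x k. u k * \<beta> x k / \<delta> k)"
  have B_alt: "B x y = (\<Sum>k\<in>K. \<beta> x k * y k)" for x y by (simp add: B_def \<beta>_def)
  have \<delta>_pos: "0 < \<delta> k" if "k \<in> K" for k
  proof -
    have "0 < H k r * u r" using star[OF that] u[OF r] sym[of k r] by simp
    also have "\<dots> \<le> \<delta> k" unfolding \<delta>_def \<beta>_def
      using u fin r by (intro member_le_sum mult_nonneg_nonneg nonneg) (auto intro: less_imp_le)
    finally show ?thesis .
  qed
  have B_sym: "B x y = B y x" for x y
  proof -
    have "B x y = (\<Sum>k\<in>K. \<Sum>j\<in>K. H k j * x j * y k)" by (simp add: B_def sum_distrib_right)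
    also have "\<dots> = (\<Sum>j\<in>K. \<Sum>k\<in>K. H k j * x j * y k)" by (rule sum.swap)
    also have "\<dots> = B y x"
      by (simp add: B_def sum_distrib_right) (intro sum.cong refl, simp add: sym mult_ac)
    finally show ?thesis .
  qed
  have B_lin: "B (\<lambda>k. a * x k + b * y k) z = a * B x z + b * B y z" for a b x y z
    by (simp add: B_def sum.distrib sum_distrib_left sum_distrib_right algebra_simps)
  have ip_sym: "ip x y = ip y x" for x y by (simp add: ip_def mult_ac)
  have ip_lin: "ip (\<lambda>k. a * x k + b * y k) z = a * ip x z + b * ip y z" for a b x y z
    by (simp add: ip_def sum.distrib sum_distrib_left algebra_simps add_divide_distrib)
  have ip_A: "ip (A x) y = B x y" for x y
    unfolding ip_def A_def B_alt
    by (intro sum.cong refl) (use \<delta>_pos u in \<open>force simp: field_simps\<close>)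
  have ip_u: "ip x u = B x u" for x
    unfolding ip_def B_sym[of x u] unfolding B_alt \<delta>_def[symmetric]
    by (intro sum.cong refl) (use \<delta>_pos u in \<open>force simp: field_simps\<close>)
  have ip_nonneg: "0 \<le> ip x x" for x
    unfolding ip_def mult.assoc using \<delta>_pos u
    by (intro sum_nonneg mult_nonneg_nonneg[of "_ / _"]) (auto intro: less_imp_le)
  have B_le_AA: "B x x \<le> ip (A x) (A x)" for x
  proof -
    have "ip (A x) (A x) = (\<Sum>k\<in>K. u k * (\<beta> x k)\<^sup>2 / \<delta> k)"
      unfolding ip_def A_def
      by (intro sum.cong refl) (use \<delta>_pos u in \<open>force simp: field_simps power2_eq_square\<close>)
    then show ?thesis using main[of x] by (simp add: \<beta>_def \<delta>_def)
  qed
  have AX: "B (A x) u = 0" if "B x u = 0" for x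
    by (metis B_sym ip_A ip_u that)
  \<comment> \<open>Perron-Frobenius made explicit: \<open>ip + s * B\<close> with \<open>s\<^sup>2 = 1\<close> is a signed graph Laplacian.\<close>
  have ip_uu: "ip x x = (\<Sum>k\<in>K. \<Sum>j\<in>K. H k j * u k * u j * (x k / u k)\<^sup>2)" for x
    unfolding ip_def \<delta>_def \<beta>_def sum_divide_distrib sum_distrib_right
    by (intro sum.cong refl) (use u in \<open>force simp: field_simps power2_eq_square\<close>)
  have ip_uu': "ip x x = (\<Sum>k\<in>K. \<Sum>j\<in>K. H k j * u k * u j * (x j / u j)\<^sup>2)" for x
    unfolding ip_uu by (subst sum.swap) (intro sum.cong refl, simp add: sym mult_ac)
  have Bxx: "B x x = (\<Sum>k\<in>K. \<Sum>j\<in>K. H k j * u k * u j * ((x k / u k) * (x j / u j)))" for x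
    unfolding B_def sum_distrib_right
    by (intro sum.cong refl) (use u in \<open>force simp: field_simps\<close>)
  have lap: "2 * (ip x x + s * B x x) = (\<Sum>k\<in>K. \<Sum>j\<in>K. H k j * u k * u j * (x k / u k + s * (x j / u j))\<^sup>2)"
    if "s\<^sup>2 = 1" for s x
  proof -
    have "(\<Sum>k\<in>K. \<Sum>j\<in>K. H k j * u k * u j * (x k / u k + s * (x j / u j))\<^sup>2)
       = (\<Sum>k\<in>K. \<Sum>j\<in>K. H k j * u k * u j * (x k / u k)\<^sup>2 + H k j * u k * u j * (x j / u j)\<^sup>2
           + 2 * s * (H k j * u k * u j * ((x k / u k) * (x j / u j))))"
    proof (intro sum.cong refl)
      fix k j
      have "(x k / u k + s * (x j / u j))\<^sup>2 = (x k / u k)\<^sup>2 + s\<^sup>2 * (x j / u j)\<^sup>2 + 2 * s * ((x k / u k) * (x j / u j))"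
        by (simp add: power2_eq_square algebra_simps)
      then show "H k j * u k * u j * (x k / u k + s * (x j / u j))\<^sup>2
        = H k j * u k * u j * (x k / u k)\<^sup>2 + H k j * u k * u j * (x j / u j)\<^sup>2
           + 2 * s * (H k j * u k * u j * ((x k / u k) * (x j / u j)))"
        by (simp add: that) (simp add: algebra_simps)
    qed
    also have "\<dots> = ip x x + ip x x + 2 * s * B x x"
      unfolding sum.distrib sum_distrib_left[symmetric]
      by (simp only: ip_uu[symmetric] ip_uu'[symmetric] Bxx[symmetric])
    finally show ?thesis by (simp add: algebra_simps)
  qed
  have term_nonneg: "0 \<le> H k j * u k * u j * c\<^sup>2" if "k \<in> K" "j \<in> K" for k j c
    using u that by (intro mult_nonneg_nonneg nonneg zero_le_power2) (auto intro: less_imp_le)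
  have B_ge: "- ip x x \<le> B x x" for x
  proof -
    have "0 \<le> 2 * (ip x x + 1 * B x x)"
      unfolding lap[of 1 x, simplified] by (subst lap) (auto intro!: sum_nonneg term_nonneg)
    then show ?thesis by simp
  qed
  define m where "m = (\<lambda>k. \<delta> k * u k)"
  define h where "h = (\<lambda>k. H r k * u r * u k)"
  have m_pos: "0 < m k" and h_pos: "0 < h k" if "k \<in> K" for k
    using that \<delta>_pos u star r by (auto simp: m_def h_def)
  define \<gamma> where "\<gamma> = Min ((\<lambda>k. h k / m k) ` K)"
  have \<gamma>_pos: "0 < \<gamma>" unfolding \<gamma>_def using fin r m_pos h_pos by (subst Min_gr_iff) auto
  have \<gamma>_le: "\<gamma> * m k \<le> h k" if "k \<in> K" for k
  proof -
    have "\<gamma> \<le> h k / m k" unfolding \<gamma>_def using fin that by (intro Min_le) auto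
    then show ?thesis using m_pos[OF that] by (simp add: field_simps)
  qed
  \<comment> \<open>Keeping only the edges at \<open>r\<close> of the Laplacian already gives a spectral gap.\<close>
  have gap: "B x x \<le> (1 - \<gamma>) * ip x x" if x: "B x u = 0" for x
  proof -
    define \<xi> where "\<xi> = (\<lambda>k. x k / u k)"
    have ipm: "ip x x = (\<Sum>k\<in>K. m k * (\<xi> k)\<^sup>2)"
      unfolding ip_def m_def \<xi>_def
      by (intro sum.cong refl) (use u in \<open>force simp: field_simps power2_eq_square\<close>)
    have "ip x u = (\<Sum>k\<in>K. m k * \<xi> k)"
      unfolding ip_def m_def \<xi>_def
      by (intro sum.cong refl) (use u in \<open>force simp: field_simps power2_eq_square\<close>)
    then have mean: "(\<Sum>k\<in>K. m k * \<xi> k) = 0" using x ip_u by simp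
    \<comment> \<open>The weighted mean of \<open>\<xi>\<close> is zero, so moving the centre from 0
      to \<open>\<xi> r\<close> can only increase the weighted second moment.\<close>
    have "(\<Sum>k\<in>K. m k * (\<xi> k - \<xi> r)\<^sup>2)
        = (\<Sum>k\<in>K. m k * (\<xi> k)\<^sup>2) - 2 * \<xi> r * (\<Sum>k\<in>K. m k * \<xi> k) + (\<Sum>k\<in>K. m k * (\<xi> r)\<^sup>2)"
      by (simp add: power2_eq_square algebra_simps sum.distrib sum_subtractf sum_distrib_left)
    then have "ip x x \<le> (\<Sum>k\<in>K. m k * (\<xi> k - \<xi> r)\<^sup>2)"
      using mean ipm m_pos by (simp add: sum_nonneg less_imp_le)
    then have "\<gamma> * ip x x \<le> \<gamma> * (\<Sum>k\<in>K. m k * (\<xi> k - \<xi> r)\<^sup>2)" using \<gamma>_pos by simp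
    also have "\<dots> \<le> (\<Sum>k\<in>K. h k * (\<xi> k - \<xi> r)\<^sup>2)"
      unfolding sum_distrib_left mult.assoc[symmetric]
      using \<gamma>_le by (intro sum_mono mult_right_mono) auto
    finally have g: "\<gamma> * ip x x \<le> (\<Sum>k\<in>K. h k * (\<xi> k - \<xi> r)\<^sup>2)" .
    define L where "L = (\<lambda>k j. H k j * u k * u j * (\<xi> k - \<xi> j)\<^sup>2)"
    have L0: "0 \<le> L k j" if "k \<in> K" "j \<in> K" for k j using term_nonneg[OF that] by (simp add: L_def)
    have L: "2 * (ip x x - B x x) = (\<Sum>k\<in>K. \<Sum>j\<in>K. L k j)"
      using lap[of "-1" x] by (simp add: L_def \<xi>_def)
    have row: "(\<Sum>j\<in>K. L r j) = (\<Sum>k\<in>K. h k * (\<xi> k - \<xi> r)\<^sup>2)"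
      by (intro sum.cong refl) (simp add: L_def h_def power2_commute)
    have col: "L k r = h k * (\<xi> k - \<xi> r)\<^sup>2" for k
      by (simp add: L_def h_def sym mult_ac)
    \<comment> \<open>Every edge at \<open>r\<close> is met twice, in row \<open>r\<close> and in
      column \<open>r\<close>, which gives the factor 2; the common entry \<open>L r r\<close> is
      zero.\<close>
    have "(\<Sum>k\<in>K. \<Sum>j\<in>K. L k j) = (\<Sum>j\<in>K. L r j) + (\<Sum>k\<in>K - {r}. \<Sum>j\<in>K. L k j)"
      using fin r by (rule sum.remove)
    moreover have "(\<Sum>k\<in>K - {r}. L k r) \<le> (\<Sum>k\<in>K - {r}. \<Sum>j\<in>K. L k j)"
      using L0 r fin by (intro sum_mono member_le_sum) auto
    moreover have "(\<Sum>k\<in>K - {r}. L k r) = (\<Sum>k\<in>K. L k r)"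
      using fin r by (subst (2) sum.remove) (auto simp: L_def)
    ultimately have "2 * (\<Sum>k\<in>K. h k * (\<xi> k - \<xi> r)\<^sup>2) \<le> 2 * (ip x x - B x x)"
      unfolding L row col by simp
    then show ?thesis using g by (simp add: algebra_simps)
  qed
  \<comment> \<open>\<open>B_le_AA\<close> says that \<open>A\<close> has no spectrum strictly between 0 and 1, so any bound \<open>l\<close> in
    that range for the Rayleigh quotient on the hyperplane can be lowered.\<close>
  have improve: "B x x \<le> l * (2 + l) / 3 * ip x x"
    if l: "0 \<le> l" "l \<le> 1" and bd: "\<And>x. B x u = 0 \<Longrightarrow> B x x \<le> l * ip x x" and x: "B x u = 0" for l x
  proof -
    \<comment> \<open>On the hyperplane the form \<open>l * ip - B\<close> is nonnegative, and it is
      at most \<open>2 * ip\<close> by \<open>B_ge\<close>. Half its gradient at \<open>x\<close> is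
      \<open>z\<close>, so a gradient step of length 1/2, the best one for this bound, leads to
      \<open>y\<close> and gives \<open>ip z z \<le> 2 * (l * ip x x - B x x)\<close>.\<close>
    define z where "z = (\<lambda>k. l * x k + (-1) * A x k)"
    define y where "y = (\<lambda>k. 1 * x k + (-1/2) * z k)"
    define p where "p = ip x x"
    define q where "q = B x x"
    define N where "N = ip (A x) (A x)"
    have "B z u = 0" unfolding z_def B_lin using x AX by simp
    then have yu: "B y u = 0" unfolding y_def B_lin using x by simp
    have zx: "ip z w = l * ip x w - B x w" for w unfolding z_def ip_lin ip_A by simp
    have Bzw: "B z w = l * B x w - B (A x) w" for w unfolding z_def B_lin by simp
    have xAx: "B x (A x) = N" unfolding N_def ip_A ..
    have zz: "ip z z = l * l * p - 2 * l * q + N"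
      unfolding zx B_sym[of x z] Bzw ip_sym[of x z] unfolding zx p_def q_def
      by (simp add: B_sym[of "A x"] xAx algebra_simps)
    have yw: "ip y w = ip x w - ip z w / 2" for w unfolding y_def ip_lin by simp
    have Byw: "B y w = B x w - B z w / 2" for w unfolding y_def B_lin by simp
    have yy: "ip y y = p - ip z x + ip z z / 4"
      unfolding yw[of y] ip_sym[of x y] ip_sym[of z y] yw[of x] yw[of z] p_def ip_sym[of x z] by (simp add: field_simps)
    have Byy: "B y y = q - B z x + B z z / 4"
      unfolding Byw[of y] B_sym[of x y] B_sym[of z y] Byw[of x] Byw[of z] q_def B_sym[of x z] by (simp add: field_simps)
    have key: "ip z z = l * ip z x - B z x"
      unfolding zx[of z] ip_sym[of x z] B_sym[of x z] ..
    have "0 \<le> l * ip y y - B y y" using bd[OF yu] by simp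
    also have "\<dots> = l * p - q - (l * ip z x - B z x) + (l * ip z z - B z z) / 4"
      unfolding yy Byy by (simp add: field_simps)
    finally have "0 \<le> l * p - q - ip z z + (l * ip z z - B z z) / 4"
      unfolding key .
    moreover have "l * ip z z - B z z \<le> 2 * ip z z"
      using B_ge[of z] mult_right_mono[OF l(2) ip_nonneg[of z]] by simp
    moreover have "z2 \<le> 2 * s" if "0 \<le> s - z2 + d / 4" "d \<le> 2 * z2" for s z2 d :: real
      using that by linarith
    ultimately have z2: "ip z z \<le> 2 * (l * p - q)" by blast
    have "q \<le> N" using B_le_AA unfolding q_def N_def .
    then have "l * l * p - 2 * l * q + q \<le> 2 * (l * p - q)" using z2 unfolding zz by simp
    then have h: "3 * q + l * l * p \<le> 2 * l * p + 2 * l * q" by (simp add: algebra_simps)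
    have "l * q \<le> l * (l * p)" using bd[OF x] l(1) unfolding p_def q_def by (rule mult_left_mono)
    then have "3 * q \<le> 2 * l * p + l * l * p" using h by (simp add: algebra_simps)
    then show ?thesis unfolding p_def q_def by (simp add: field_simps)
  qed
  show ?thesis
  proof (rule ccontr)
    assume "\<not> B x x \<le> 0"
    then have pos: "0 < B x x" by simp
    \<comment> \<open>If \<open>B\<close> is positive somewhere on the hyperplane, the least bound
      \<open>l\<close> for the Rayleigh quotient lies strictly between 0 and 1, the upper estimate
      coming from \<open>gap\<close>. Then \<open>(2 + l) / 3 < 1\<close>, and
      \<open>improve\<close> yields a smaller bound.\<close>
    define Ls where "Ls = {l. 0 \<le> l \<and> (\<forall>x. B x u = 0 \<longrightarrow> B x x \<le> l * ip x x)}"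
    have ippos: "0 < ip x x"
      using gap[OF orth] pos ip_nonneg[of x] by (cases "ip x x = 0") auto
    have ne: "max 0 (1 - \<gamma>) \<in> Ls" unfolding Ls_def
    proof (intro CollectI conjI allI impI)
      fix x assume "B x u = 0"
      then have "B x x \<le> (1 - \<gamma>) * ip x x" by (rule gap)
      also have "\<dots> \<le> max 0 (1 - \<gamma>) * ip x x" by (intro mult_right_mono ip_nonneg) simp
      finally show "B x x \<le> max 0 (1 - \<gamma>) * ip x x" .
    qed simp
    define l where "l = Inf Ls"
    have bdd: "bdd_below Ls" unfolding Ls_def by (intro bdd_belowI[of _ 0]) auto
    have lower: "B y y / ip y y \<le> l" if "B y u = 0" "0 < ip y y" for y
      unfolding l_def
    proof (rule cInf_greatest)
      show "Ls \<noteq> {}" using ne by blast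
    qed (use that in \<open>simp add: Ls_def pos_divide_le_eq\<close>)
    have "B x x / ip x x \<le> l" using lower orth ippos by blast
    then have l0: "0 < l" using pos ippos by (smt (verit) divide_pos_pos)
    have l1: "l < 1" using cInf_lower[OF ne bdd] \<gamma>_pos unfolding l_def by linarith
    have bd: "B y y \<le> l * ip y y" if y: "B y u = 0" for y
    proof (cases "ip y y = 0")
      case True
      then show ?thesis using gap[OF y] by simp
    next
      case False
      then have "0 < ip y y" using ip_nonneg[of y] by simp
      then have "B y y / ip y y \<le> l" using lower y by blast
      then show ?thesis using \<open>0 < ip y y\<close> by (simp add: field_simps)
    qed
    have "l * (2 + l) / 3 \<in> Ls" unfolding Ls_def using improve[of l] l0 l1 bd by auto
    then have "l \<le> l * (2 + l) / 3" unfolding l_def using cInf_lower[OF _ bdd] by blast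
    then have "l * 1 \<le> l * ((2 + l) / 3)" by simp
    then have "1 \<le> (2 + l) / 3" using l0 by (subst (asm) mult_le_cancel_left_pos)
    then show False using l1 by simp
  qed
qed

text \<open>The Hessian of \<open>dir_deriv u w\<close> at \<open>J\<close> is the
  \<open>u\<close>-weighted sum of the Hessians \<open>Q k\<close> of the coordinate derivatives,
  while its row \<open>k\<close> paired with \<open>x\<close> is \<open>Q k x u\<close>. Reverse
  Cauchy-Schwarz for each \<open>Q k\<close> in the direction \<open>u\<close> therefore adds up to
  the hypothesis \<open>main\<close> of \<open>star_negative_semidefinite\<close>.\<close>

lemma hyperbolic_dir_deriv_pos:
  fixes w :: "'a::finite set \<Rightarrow> real"
  assumes hyp: "hyperbolic w" and her: "hereditary w" and u: "\<And>i. 0 < u i"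
  shows "hyperbolic (dir_deriv u w)"
  unfolding hyperbolic_def
proof (intro allI impI)
  fix J and x p :: "'a option \<Rightarrow> real"
  assume p: "\<forall>i. 0 \<le> p i"
  have her': "hereditary (dir_deriv u w)" using her u by (intro hereditary_dir_deriv) (auto intro: less_imp_le)
  define H where "H = (\<lambda>i j. coord_deriv i (coord_deriv j (dir_deriv u w)) J)"
  \<comment> \<open>Rows and columns of \<open>H\<close> outside \<open>K\<close> vanish, so the
    form lives on \<open>K\<close>, where the positivity required of a star can hold.\<close>
  define K where "K = {i. coord_deriv i w J \<noteq> 0}"
  define Q where "Q = (\<lambda>k x z. coord_deriv k (dir_deriv x (dir_deriv z w)) J)"
  have H_nonneg: "0 \<le> H i j" for i j
    unfolding H_def by (intro coord_deriv_nonneg hereditary_coord_deriv her')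
  have H_sym: "H i j = H j i" for i j by (simp add: H_def coord_deriv_commute)
  have H_zero: "H i j = 0" if "j \<notin> K" for i j
  proof -
    have "H i j = (\<Sum>k\<in>UNIV. u k * coord_deriv k (coord_deriv i (coord_deriv j w)) J)"
      unfolding H_def coord_deriv_dir_deriv dir_deriv_def ..
    also have "\<dots> = 0"
      using that by (intro sum.neutral ballI) (simp add: K_def coord_deriv_eq_0 hereditary_coord_deriv her)
    finally show ?thesis .
  qed
  have H_zero': "H i j = 0" if "i \<notin> K" for i j using H_zero[OF that] H_sym by metis
  have row: "(\<Sum>j\<in>K. H k j * x j) = Q k x u" for k x
  proof -
    have "(\<Sum>j\<in>K. H k j * x j) = (\<Sum>j\<in>UNIV. H k j * x j)"
      by (rule sum.mono_neutral_left) (auto simp: H_zero)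
    also have "\<dots> = dir_deriv x (coord_deriv k (dir_deriv u w)) J"
      unfolding H_def dir_deriv_def[of x] by (simp add: coord_deriv_commute mult.commute)
    finally show ?thesis by (simp add: Q_def coord_deriv_dir_deriv)
  qed
  define B where "B = (\<lambda>x y. \<Sum>k\<in>K. (\<Sum>j\<in>K. H k j * x j) * y k)"
  have Q_zero: "Q k x z = 0" if "k \<notin> K" for k x z
    unfolding Q_def coord_deriv_dir_deriv dir_deriv_dir_deriv_eq using that
    by (intro sum.neutral ballI) (simp add: K_def coord_deriv_eq_0 hereditary_coord_deriv her)
  have B_eq: "dir_deriv x (dir_deriv z (dir_deriv u w)) J = B x z" for x z
  proof -
    have "dir_deriv x (dir_deriv z (dir_deriv u w)) J = dir_deriv z (dir_deriv x (dir_deriv u w)) J" by (simp add: dir_deriv_commute)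
    also have "\<dots> = (\<Sum>k\<in>UNIV. Q k x u * z k)"
      unfolding Q_def by (subst dir_deriv_def) (simp add: mult.commute)
    also have "\<dots> = (\<Sum>k\<in>K. Q k x u * z k)"
      by (rule sum.mono_neutral_right) (auto simp: Q_zero)
    finally show ?thesis by (simp add: B_def row)
  qed
  show "dir_deriv x (dir_deriv x (dir_deriv u w)) J * dir_deriv p (dir_deriv p (dir_deriv u w)) J \<le> (dir_deriv x (dir_deriv p (dir_deriv u w)) J)\<^sup>2"
  proof (cases "w J = 0")
    case True
    then have "Q k x z = 0" for k x z using Q_zero by (simp add: K_def coord_deriv_eq_0 her)
    then show ?thesis by (simp add: B_eq B_def row)
  next
    case False
    have NK: "None \<in> K" using False by (simp add: K_def coord_deriv_def)
    have pos: "0 < coord_deriv k w J" if "k \<in> K" for k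
      using that coord_deriv_nonneg[OF her, of k J] by (simp add: K_def)
    \<comment> \<open>The derivative of index \<open>None\<close> is the identity, so one summand is
      a positive first derivative. This makes \<open>None\<close> the centre of the star.\<close>
    have Hpos: "0 < H None k" if "k \<in> K" for k
    proof -
      have "H None k = (\<Sum>i\<in>UNIV. u i * coord_deriv i (coord_deriv k w) J)"
        unfolding H_def coord_deriv_dir_deriv dir_deriv_def by simp
      also have "\<dots> \<ge> u None * coord_deriv None (coord_deriv k w) J"
        using u by (intro member_le_sum mult_nonneg_nonneg coord_deriv_nonneg hereditary_coord_deriv her)
          (auto intro: less_imp_le)
      moreover have "0 < u None * coord_deriv None (coord_deriv k w) J"
        using u[of None] pos[OF that] by (simp add: coord_deriv_def)
      ultimately show ?thesis by linarith
    qed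
    have Quu: "0 < Q k u u" if "k \<in> K" for k
    proof -
      have "0 < H k None * u None" using Hpos[OF that] u H_sym by simp
      also have "\<dots> \<le> (\<Sum>j\<in>K. H k j * u j)"
        using u NK by (intro member_le_sum mult_nonneg_nonneg H_nonneg) (auto intro: less_imp_le)
      finally show ?thesis by (simp add: row)
    qed
    have main: "B x x \<le> (\<Sum>k\<in>K. u k * (\<Sum>j\<in>K. H k j * x j)\<^sup>2 / (\<Sum>j\<in>K. H k j * u j))" for x
    proof -
      have "B x x = dir_deriv u (dir_deriv x (dir_deriv x w)) J"
        by (metis B_eq dir_deriv_commute)
      also have "\<dots> = (\<Sum>k\<in>UNIV. u k * Q k x x)" by (simp add: dir_deriv_def[of u] Q_def)
      also have "\<dots> = (\<Sum>k\<in>K. u k * Q k x x)"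
        by (rule sum.mono_neutral_right) (auto simp: Q_zero)
      also have "\<dots> \<le> (\<Sum>k\<in>K. u k * (Q k x u)\<^sup>2 / Q k u u)"
      proof (rule sum_mono)
        fix k assume k: "k \<in> K"
        have "Q k x x * Q k u u \<le> (Q k x u)\<^sup>2"
        proof (cases k)
          case None
          then show ?thesis using hyp u unfolding hyperbolic_def Q_def
            by (simp add: coord_deriv_def less_imp_le)
        next
          case (Some a)
          \<comment> \<open>For \<open>a\<close> outside \<open>J\<close>, deriving by
            \<open>a\<close> and evaluating at \<open>J\<close> means evaluating at
            \<open>insert a J\<close>, and \<open>hyperbolic\<close> covers all sets.\<close>
          then have "a \<notin> J" using k by (auto simp: K_def coord_deriv_def)
          then show ?thesis using Some hyp u unfolding hyperbolic_def Q_def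
            by (simp add: coord_deriv_def less_imp_le)
        qed
        then have "Q k x x \<le> (Q k x u)\<^sup>2 / Q k u u" using Quu[OF k] by (simp add: field_simps)
        then show "u k * Q k x x \<le> u k * (Q k x u)\<^sup>2 / Q k u u"
          using u[of k] by (metis mult_left_mono less_imp_le times_divide_eq_right)
      qed
      finally show ?thesis by (simp add: row)
    qed
    have neg: "B x x \<le> 0" if "B x u = 0" for x
      using star_negative_semidefinite[of K None H u x] NK H_sym H_nonneg Hpos u main that
      unfolding B_def by auto
    have B_sym: "B x y = B y x" for x y by (metis B_eq dir_deriv_commute)
    have B_lin: "B (\<lambda>k. x k + t * y k) z = B x z + t * B y z" for x y z t
      by (simp add: B_def sum.distrib sum_distrib_left sum_distrib_right algebra_simps)
    have B_lin_right: "B z (\<lambda>k. x k + t * y k) = B z x + t * B z y" for x y z t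
      by (simp add: B_def sum.distrib sum_distrib_left sum_distrib_right algebra_simps)
    define b where "b = B u u"
    have b: "0 < b" unfolding b_def B_def
      using NK Quu u by (intro sum_pos) (auto simp: row)
    \<comment> \<open>This splits \<open>B\<close> into a positive rank one form minus
      \<open>E\<close>. Since \<open>E x x\<close> is \<open>- B y y\<close> for the component
      \<open>y\<close> of \<open>x\<close> orthogonal to \<open>u\<close>, the form \<open>E\<close>
      is positive semidefinite.\<close>
    define E where "E = (\<lambda>x z. B x u * B z u / b - B x z)"
    have E_nonneg: "0 \<le> E x x" for x
    proof -
      define y where "y = (\<lambda>k. x k + (- B x u / b) * u k)"
      have yu: "B y z = B x z - B x u / b * B u z" for z unfolding y_def B_lin by simp
      have "B y u = 0" using b by (simp add: yu b_def[symmetric])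
      then have "B y y \<le> 0" by (rule neg)
      moreover have "B y y = - E x x"
        unfolding yu[of y] B_sym[of x y] B_sym[of u y] yu[of x] yu[of u] E_def
        using b by (simp add: B_sym[of u x] b_def[symmetric] field_simps)
      ultimately show ?thesis by simp
    qed
    have "(E x p)\<^sup>2 \<le> E x x * E p p"
    proof (rule quadratic_nonneg_discriminant)
      fix t
      have "E (\<lambda>k. x k + t * p k) (\<lambda>k. x k + t * p k) = E x x + 2 * E x p * t + E p p * t\<^sup>2"
        unfolding E_def B_lin B_lin_right
        using b by (simp add: B_sym[of p x] power2_eq_square field_simps)
      then show "0 \<le> E x x + 2 * E x p * t + E p p * t\<^sup>2" using E_nonneg by metis
    qed (rule E_nonneg)
    moreover have "0 \<le> B p p"
      unfolding B_def using p H_nonneg by (auto intro!: sum_nonneg mult_nonneg_nonneg)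
    ultimately have "(B x u * B x u / b - E x x) * (B p u * B p u / b - E p p) \<le> (B x u * B p u / b - E x p)\<^sup>2"
      by (intro reverse_cauchy_diff E_nonneg) (auto simp: power2_eq_square E_def mult_ac)
    then show ?thesis by (simp add: E_def B_eq)
  qed
qed

text \<open>Approximation by the strictly positive directions \<open>u + e\<close>: both sides of
  the inequality are polynomial in \<open>e\<close>, so it survives the limit from the
  right.\<close>

lemma hyperbolic_dir_deriv:
  fixes w :: "'a::finite set \<Rightarrow> real"
  assumes hyp: "hyperbolic w" and her: "hereditary w" and u: "\<And>i. 0 \<le> u i"
  shows "hyperbolic (dir_deriv u w)"
  unfolding hyperbolic_def
proof (intro allI impI)
  fix J and x p :: "'a option \<Rightarrow> real"
  assume p: "\<forall>i. 0 \<le> p i"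
  define Q where "Q = (\<lambda>v x z. dir_deriv x (dir_deriv z (dir_deriv v w)) J)"
  have Q: "Q (\<lambda>i. u i + e * 1) x z = Q u x z + e * Q (\<lambda>i. 1) x z" for e x z
    unfolding Q_def dir_deriv_add_left[of u e] by (simp add: dir_deriv_add_right)
  have "(Q u x x + e * Q (\<lambda>i. 1) x x) * (Q u p p + e * Q (\<lambda>i. 1) p p)
    \<le> (Q u x p + e * Q (\<lambda>i. 1) x p)\<^sup>2" if "0 < e" for e
    unfolding Q[symmetric] unfolding Q_def
    using hyperbolic_dir_deriv_pos[OF hyp her, of "\<lambda>i. u i + e * 1"] u that p
    unfolding hyperbolic_def by (simp add: add_nonneg_pos)
  then have ev: "\<forall>\<^sub>F e in at_right 0. (Q u x x + e * Q (\<lambda>i. 1) x x) * (Q u p p + e * Q (\<lambda>i. 1) p p)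
    \<le> (Q u x p + e * Q (\<lambda>i. 1) x p)\<^sup>2"
    by (rule eventually_mono[OF eventually_at_right_less])
  have "Q u x x * Q u p p \<le> (Q u x p)\<^sup>2"
  proof (rule tendsto_le[OF _ _ _ ev])
    show "((\<lambda>e. (Q u x p + e * Q (\<lambda>i. 1) x p)\<^sup>2) \<longlongrightarrow> (Q u x p)\<^sup>2) (at_right 0)"
      by (auto intro!: tendsto_eq_intros)
    show "((\<lambda>e. (Q u x x + e * Q (\<lambda>i. 1) x x) * (Q u p p + e * Q (\<lambda>i. 1) p p)) \<longlongrightarrow> Q u x x * Q u p p) (at_right 0)"
      by (auto intro!: tendsto_eq_intros)
  qed simp
  then show "dir_deriv x (dir_deriv x (dir_deriv u w)) J * dir_deriv p (dir_deriv p (dir_deriv u w)) J \<le> (dir_deriv x (dir_deriv p (dir_deriv u w)) J)\<^sup>2"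
    by (simp add: Q_def)
qed

section \<open>Independent sets of matroids\<close>

definition indep :: "'a set set \<Rightarrow> 'a set \<Rightarrow> bool" where
  "indep \<B> S \<longleftrightarrow> (\<exists>B\<in>\<B>. S \<subseteq> B)"

lemma card_bases_eq:
  fixes \<B> :: "'a::finite set set"
  assumes m: "matroid_bases \<B>" and "B1 \<in> \<B>" "B2 \<in> \<B>"
  shows "card B1 = card B2"
  using assms(2)
proof (induction "card (B1 - B2)" arbitrary: B1 rule: less_induct)
  case less
  show ?case
  proof (cases "B1 \<subseteq> B2")
    case True
    have "B2 - B1 = {}" using m assms(3) less.prems True unfolding matroid_bases_def by blast
    then show ?thesis using True by (metis Diff_eq_empty_iff equalityI)
  next
    case False
    then obtain x where x: "x \<in> B1 - B2" by blast
    then obtain y where y: "y \<in> B2 - B1" "insert y (B1 - {x}) \<in> \<B>"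
      using bspec[OF bspec[OF bspec[OF conjunct2[OF m[unfolded matroid_bases_def]] less.prems] assms(3)] x]
      by blast
    have "insert y (B1 - {x}) - B2 \<subset> B1 - B2" using x y(1) by auto
    then have "card (insert y (B1 - {x}) - B2) < card (B1 - B2)" by (simp add: psubset_card_mono)
    then have "card (insert y (B1 - {x})) = card B2" using less.hyps y(2) by blast
    moreover have "card (insert y (B1 - {x})) = Suc (card (B1 - {x}))"
      using y(1) by (intro card_insert_disjoint) auto
    moreover have "Suc (card (B1 - {x})) = card B1" using x by (intro card_Suc_Diff1) auto
    ultimately show ?thesis by simp
  qed
qed

text \<open>A basis containing \<open>S\<close> with as few elements as possible outside
  \<open>S \<union> B\<close> has none there, since exchanging such an element against
  \<open>B\<close> would lower their number.\<close>

lemma indep_extend: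
  fixes \<B> :: "'a::finite set set"
  assumes m: "matroid_bases \<B>" and S: "indep \<B> S" and B: "B \<in> \<B>"
  obtains B' where "B' \<in> \<B>" "S \<subseteq> B'" "B' \<subseteq> S \<union> B"
proof -
  define P where "P = (\<lambda>B'. B' \<in> \<B> \<and> S \<subseteq> B')"
  obtain B0 where "P B0" using S by (auto simp: indep_def P_def)
  then obtain B' where B': "P B'" and min: "\<And>C. P C \<Longrightarrow> card (B' - (S \<union> B)) \<le> card (C - (S \<union> B))"
    using ex_has_least_nat[of P B0 "\<lambda>C. card (C - (S \<union> B))"] by blast
  have "B' \<subseteq> S \<union> B"
  proof (rule ccontr)
    assume "\<not> B' \<subseteq> S \<union> B"
    then obtain x where x: "x \<in> B'" "x \<notin> S" "x \<notin> B" by blast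
    then obtain y where y: "y \<in> B - B'" "insert y (B' - {x}) \<in> \<B>"
      using m B B' unfolding matroid_bases_def P_def by blast
    then have "P (insert y (B' - {x}))" using B' x by (auto simp: P_def)
    moreover have "insert y (B' - {x}) - (S \<union> B) \<subset> B' - (S \<union> B)" using x y(1) by auto
    then have "card (insert y (B' - {x}) - (S \<union> B)) < card (B' - (S \<union> B))"
      by (simp add: psubset_card_mono)
    ultimately show False using min by fastforce
  qed
  then show ?thesis using that B' by (auto simp: P_def)
qed

text \<open>Contrapositive of the transitivity of parallelism in the contraction by
  \<open>J\<close>: if \<open>b\<close> is parallel to both \<open>a\<close> and \<open>c\<close>,
  then \<open>a\<close> and \<open>c\<close> are parallel.\<close>

lemma indep_insert_trans:
  fixes \<B> :: "'a::finite set set"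
  assumes m: "matroid_bases \<B>" and ac: "indep \<B> (insert a (insert c J))"
    and b: "indep \<B> (insert b J)" and "a \<noteq> c" "a \<notin> J" "c \<notin> J"
  shows "indep \<B> (insert a (insert b J)) \<or> indep \<B> (insert b (insert c J))"
proof -
  obtain B where B: "B \<in> \<B>" "insert a (insert c J) \<subseteq> B" using ac by (auto simp: indep_def)
  obtain B' where B': "B' \<in> \<B>" "insert b J \<subseteq> B'" "B' \<subseteq> insert b J \<union> B"
    using indep_extend[OF m b B(1)] .
  have "a \<in> B' \<or> c \<in> B'"
  proof (rule ccontr)
    assume h: "\<not> (a \<in> B' \<or> c \<in> B')"
    have "B' \<subseteq> insert b (B - {a, c})" using B B' h by auto
    then have "card B' \<le> card (insert b (B - {a, c}))" by (intro card_mono) auto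
    also have "\<dots> \<le> Suc (card (B - {a, c}))" by (simp add: card_insert_if)
    finally have "card B' \<le> Suc (card (B - {a, c}))" .
    moreover have "card (B - {a, c}) = card B - 2" using B assms(4) by (subst card_Diff_subset) auto
    moreover have "card B \<ge> 2" using B assms(4) card_mono[of B "{a,c}"] by auto
    ultimately show False using card_bases_eq[OF m B(1) B'(1)] by simp
  qed
  then show ?thesis using B' by (auto simp: indep_def)
qed

section \<open>Hessians of the homogenised independence polynomial\<close>

lemma sum_option_UNIV: "(\<Sum>i\<in>UNIV. f i) = f None + (\<Sum>a\<in>UNIV. f (Some a))"
  for f :: "'a::finite option \<Rightarrow> real"
  unfolding UNIV_option_conv by (subst sum.insert) (auto simp: sum.reindex)

text \<open>The right-hand side is the sum of the squares of the sums over the fibres of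
  \<open>f\<close>. There are at most \<open>M\<close> nonempty fibres, so this is Cauchy-Schwarz
  over the fibres.\<close>

lemma sum_square_le_classes:
  fixes x :: "'a \<Rightarrow> real"
  assumes "finite C" "real (card C) \<le> M" "0 < M"
  shows "(\<Sum>a\<in>C. x a)\<^sup>2 / M \<le> (\<Sum>a\<in>C. \<Sum>b\<in>C. if f a = f b then x a * x b else 0)"
proof -
  define X where "X = (\<lambda>y. \<Sum>a | a \<in> C \<and> f a = y. x a)"
  have "(\<Sum>a\<in>C. \<Sum>b\<in>C. if f a = f b then x a * x b else 0) = (\<Sum>a\<in>C. x a * X (f a))"
  proof (rule sum.cong[OF refl])
    fix a
    have "(\<Sum>b\<in>C. if f a = f b then x a * x b else 0) = (\<Sum>b\<in>C. if f b = f a then x a * x b else 0)"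
      by (intro sum.cong refl) auto
    also have "\<dots> = x a * X (f a)"
      unfolding X_def sum_distrib_left by (rule sum.inter_filter[OF assms(1), symmetric])
    finally show "(\<Sum>b\<in>C. if f a = f b then x a * x b else 0) = x a * X (f a)" .
  qed
  also have "\<dots> = (\<Sum>y\<in>f ` C. \<Sum>a | a \<in> C \<and> f a = y. x a * X (f a))"
    by (rule sum.image_gen[OF assms(1)])
  also have "\<dots> = (\<Sum>y\<in>f ` C. (X y)\<^sup>2)"
    unfolding X_def power2_eq_square sum_distrib_right by (intro sum.cong refl) auto
  finally have R: "(\<Sum>a\<in>C. \<Sum>b\<in>C. if f a = f b then x a * x b else 0) = (\<Sum>y\<in>f ` C. (X y)\<^sup>2)" .
  have "(\<Sum>a\<in>C. x a) = (\<Sum>y\<in>f ` C. X y)" unfolding X_def by (rule sum.image_gen[OF assms(1)])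
  then have "(\<Sum>a\<in>C. x a)\<^sup>2 \<le> real (card (f ` C)) * (\<Sum>y\<in>f ` C. (X y)\<^sup>2)"
    using sum_squared_le_sum_of_squares[of X "f ` C"] by (simp add: mult.commute)
  also have "\<dots> \<le> M * (\<Sum>y\<in>f ` C. (X y)\<^sup>2)"
    using card_image_le[OF assms(1), of f] assms(2)
    by (intro mult_right_mono sum_nonneg) auto
  finally show ?thesis using R assms(3) by (simp add: field_simps)
qed

text \<open>In degree \<open>N\<close> the factorial cancels the one in the normalisation of
  weights, so every independent set gets coefficient 1.\<close>

definition mason_weight :: "nat \<Rightarrow> 'a set set \<Rightarrow> 'a set \<Rightarrow> real" where
  "mason_weight N \<B> S = (if indep \<B> S then fact (N - card S) else 0)"

lemma hereditary_mason_weight: "hereditary (mason_weight N \<B>)"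
  by (auto simp: hereditary_def mason_weight_def indep_def)

text \<open>With \<open>M = N - card J\<close>, the Hessian at an independent \<open>J\<close> has
  the entry \<open>fact M\<close> at (\<open>None\<close>, \<open>None\<close>),
  \<open>fact (M - 1)\<close> between \<open>None\<close> and a non-loop of the contraction, and
  \<open>fact (M - 2)\<close> between non-parallel non-loops. Completing the square in the
  \<open>None\<close> coordinate leaves a rank one form minus a semidefinite form, because there are
  at most \<open>M\<close> non-loops.\<close>

lemma hyperbolic_mason_weight:
  fixes \<B> :: "'a::finite set set"
  assumes m: "matroid_bases \<B>" and N: "CARD('a) \<le> N"
    and rank: "\<And>B. B \<in> \<B> \<Longrightarrow> card B + 2 \<le> N"
  shows "hyperbolic (mason_weight N \<B>)"
  unfolding hyperbolic_def
proof (intro allI impI)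
  fix J and x p :: "'a option \<Rightarrow> real"
  assume p: "\<forall>i. 0 \<le> p i"
  define w where "w = mason_weight N \<B>"
  define Q where "Q = (\<lambda>x z. dir_deriv x (dir_deriv z w) J)"
  have her: "hereditary w" unfolding w_def by (rule hereditary_mason_weight)
  show "dir_deriv x (dir_deriv x (mason_weight N \<B>)) J * dir_deriv p (dir_deriv p (mason_weight N \<B>)) J
    \<le> (dir_deriv x (dir_deriv p (mason_weight N \<B>)) J)\<^sup>2"
  proof (cases "indep \<B> J")
    case False
    then have "w J = 0" by (simp add: w_def mason_weight_def)
    then have "Q x z = 0" for x z
      unfolding Q_def dir_deriv_dir_deriv_eq by (intro sum.neutral ballI) (simp add: coord_deriv_eq_0 hereditary_coord_deriv her)
    then show ?thesis by (simp add: Q_def w_def)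
  next
    case True
    define C where "C = {a. a \<notin> J \<and> indep \<B> (insert a J)}"
    define M where "M = N - card J"
    define \<phi> :: real where "\<phi> = fact (M - 2)"
    \<comment> \<open>The parallel class of \<open>a\<close> in the contraction by
      \<open>J\<close>.\<close>
    define f where "f = (\<lambda>a. {b \<in> C. b = a \<or> \<not> indep \<B> (insert a (insert b J))})"
    \<comment> \<open>The bound on the size of bases keeps the natural subtractions
      \<open>M - 1\<close> and \<open>M - 2\<close> from being truncated.\<close>
    have M2: "2 \<le> M"
    proof -
      obtain B where "B \<in> \<B>" "J \<subseteq> B" using True by (auto simp: indep_def)
      then show ?thesis using rank[of B] card_mono[of B J] by (simp add: M_def)
    qed
    have M: "real M \<ge> 2" using M2 by simp
    have \<phi>: "0 < \<phi>" by (simp add: \<phi>_def)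
    have fact1: "fact (M - 1) = (real M - 1) * \<phi>"
    proof -
      obtain k where "M = Suc (Suc k)" using M2 by (metis add_2_eq_Suc le_Suc_ex)
      then show ?thesis by (simp add: \<phi>_def algebra_simps)
    qed
    have fact0: "fact M = real M * (real M - 1) * \<phi>"
      using fact1 M2 by (simp add: fact_reduce[of M])
    have cC: "card C \<le> M"
    proof -
      have "card C \<le> card (- J)" by (rule card_mono) (auto simp: C_def)
      also have "\<dots> = CARD('a) - card J" by (simp add: Compl_eq_Diff_UNIV card_Diff_subset)
      finally show ?thesis using N by (simp add: M_def)
    qed
    have cls: "f a = f b \<longleftrightarrow> a = b \<or> \<not> indep \<B> (insert a (insert b J))" if "a \<in> C" "b \<in> C" for a b
    proof
      assume "f a = f b"
      then have "b \<in> f a" using that by (simp add: f_def)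
      then show "a = b \<or> \<not> indep \<B> (insert a (insert b J))" by (auto simp: f_def)
    next
      assume "a = b \<or> \<not> indep \<B> (insert a (insert b J))"
      then show "f a = f b"
      proof
        assume ab: "\<not> indep \<B> (insert a (insert b J))"
        have tr: "\<not> indep \<B> (insert b (insert c J))"
          if "c \<in> C" "c \<noteq> b" "\<not> indep \<B> (insert a (insert c J))" "a \<in> C" "b \<in> C"
            "\<not> indep \<B> (insert a (insert b J))" for a b c
          using indep_insert_trans[OF m, of b c J a] that unfolding C_def
          by (auto simp: insert_commute)
        show "f a = f b" using tr[of _ b a] tr[of _ a b] that ab
          by (auto simp: f_def insert_commute)
      qed simp
    qed
    have pdw: "coord_deriv (Some a) w J = (if a \<in> C then (real M - 1) * \<phi> else 0)" for a
      using fact1 by (auto simp: coord_deriv_def w_def mason_weight_def C_def M_def)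
    have pdpdw: "coord_deriv (Some a) (coord_deriv (Some b) w) J = (if a \<in> C \<and> b \<in> C \<and> f a \<noteq> f b then \<phi> else 0)" for a b
    proof (cases "a \<in> C \<and> b \<in> C")
      case True
      then have "card (insert b (insert a J)) = Suc (Suc (card J))" if "a \<noteq> b"
        using that by (auto simp: C_def)
      then show ?thesis using True cls[of a b]
        by (auto simp: coord_deriv_def w_def mason_weight_def C_def \<phi>_def M_def insert_commute)
    next
      case False
      then have "coord_deriv (Some a) w J = 0 \<or> coord_deriv (Some b) w J = 0" using pdw by auto
      then have "coord_deriv (Some a) (coord_deriv (Some b) w) J = 0"
        using coord_deriv_eq_0[OF hereditary_coord_deriv[OF her]] coord_deriv_commute by metis
      then show ?thesis using False by auto
    qed
    define X where "X = (\<lambda>x. \<Sum>a\<in>C. x (Some a) :: real)"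
    define R where "R = (\<lambda>x z. \<Sum>a\<in>C. \<Sum>b\<in>C. if f a = f b then x (Some a) * z (Some b) :: real else 0)"
    \<comment> \<open>\<open>L\<close> is the completed square, and \<open>E\<close> collects what
      is left: the products within parallel classes minus the part of \<open>X x * X z\<close> used
      up by the square.\<close>
    define E where "E = (\<lambda>x z. \<phi> * (R x z - X x * X z / M))"
    define L where "L = (\<lambda>x. x None + X x / M)"
    have Qeq: "Q x z = \<phi> * (M * (M - 1)) * (L x * L z) - E x z" for x z
    proof -
      have "Q x z = x None * z None * fact M
         + (\<Sum>b\<in>UNIV. x None * z (Some b) * coord_deriv (Some b) w J)
         + (\<Sum>a\<in>UNIV. x (Some a) * z None * coord_deriv (Some a) w J)
         + (\<Sum>a\<in>UNIV. \<Sum>b\<in>UNIV. x (Some a) * z (Some b) * coord_deriv (Some a) (coord_deriv (Some b) w) J)"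
        unfolding Q_def dir_deriv_dir_deriv_eq sum_option_UNIV sum.distrib using True
        by (simp add: w_def mason_weight_def M_def)
      also have "(\<Sum>b\<in>UNIV. x None * z (Some b) * coord_deriv (Some b) w J) = x None * (real M - 1) * \<phi> * X z"
        unfolding X_def sum_distrib_left pdw
        by (rule sum.mono_neutral_cong_right) auto
      also have "(\<Sum>a\<in>UNIV. x (Some a) * z None * coord_deriv (Some a) w J) = z None * (real M - 1) * \<phi> * X x"
        unfolding X_def sum_distrib_left pdw
        by (rule sum.mono_neutral_cong_right) auto
      also have "(\<Sum>a\<in>UNIV. \<Sum>b\<in>UNIV. x (Some a) * z (Some b) * coord_deriv (Some a) (coord_deriv (Some b) w) J)
          = (\<Sum>a\<in>C. \<Sum>b\<in>C. if f a = f b then 0 else \<phi> * (x (Some a) * z (Some b)))"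
        unfolding pdpdw
        by (rule sum.mono_neutral_cong_right) (auto intro!: sum.mono_neutral_cong_right)
      also have "\<dots> = (\<Sum>a\<in>C. \<Sum>b\<in>C. \<phi> * (x (Some a) * z (Some b)))
          - (\<Sum>a\<in>C. \<Sum>b\<in>C. if f a = f b then \<phi> * (x (Some a) * z (Some b)) else 0)"
        unfolding sum_subtractf[symmetric] by (intro sum.cong refl) auto
      also have "(\<Sum>a\<in>C. \<Sum>b\<in>C. \<phi> * (x (Some a) * z (Some b))) = \<phi> * (X x * X z)"
        unfolding X_def sum_product by (simp add: sum_distrib_left)
      also have "(\<Sum>a\<in>C. \<Sum>b\<in>C. if f a = f b then \<phi> * (x (Some a) * z (Some b)) else 0) = \<phi> * R x z"
        unfolding R_def sum_distrib_left by (intro sum.cong refl) auto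
      finally have "Q x z = x None * z None * (M * (M - 1) * \<phi>) + x None * (M - 1) * \<phi> * X z
          + z None * (M - 1) * \<phi> * X x + (\<phi> * (X x * X z) - \<phi> * R x z)"
        using M2 by (simp add: fact0)
      also have "\<dots> = \<phi> * (M * (M - 1)) * (L x * L z) - E x z"
      proof -
        have "x0 * z0 * (m * (m - 1) * f) + x0 * (m - 1) * f * s + z0 * (m - 1) * f * q + (f * (q * s) - f * t)
          = f * (m * (m - 1)) * ((x0 + q / m) * (z0 + s / m)) - f * (t - q * s / m)"
          if "m \<noteq> 0" for x0 z0 m f q s t :: real
          using that by (simp add: field_simps)
        then show ?thesis using M2 unfolding E_def L_def by simp
      qed
      finally show ?thesis .
    qed
    have E_nonneg: "0 \<le> E x x" for x
      using sum_square_le_classes[of C M "\<lambda>a. x (Some a)" f] cC M \<phi>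
      by (simp add: E_def R_def X_def power2_eq_square)
    have lin: "X (\<lambda>i. x i + t * z i) = X x + t * X z" for x z t
      by (simp add: X_def sum.distrib sum_distrib_left)
    have R_lin: "R (\<lambda>i. x i + t * z i) y = R x y + t * R z y" for x z t y
      unfolding R_def sum_distrib_left sum.distrib[symmetric]
      by (intro sum.cong refl) (auto simp: algebra_simps)
    have R_lin_right: "R y (\<lambda>i. x i + t * z i) = R y x + t * R y z" for x z t y
      unfolding R_def sum_distrib_left sum.distrib[symmetric]
      by (intro sum.cong refl) (auto simp: algebra_simps)
    have R_sym: "R x z = R z x" for x z
      unfolding R_def by (subst sum.swap) (intro sum.cong refl, auto)
    have "(E x p)\<^sup>2 \<le> E x x * E p p"
    proof (rule quadratic_nonneg_discriminant)
      fix t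
      have "E (\<lambda>i. x i + t * p i) (\<lambda>i. x i + t * p i) = E x x + 2 * E x p * t + E p p * t\<^sup>2"
        unfolding E_def lin R_lin R_lin_right
        using M by (simp add: R_sym[of p x] power2_eq_square field_simps)
      then show "0 \<le> E x x + 2 * E x p * t + E p p * t\<^sup>2" using E_nonneg by metis
    qed (rule E_nonneg)
    moreover have "0 \<le> Q p p"
      unfolding Q_def dir_deriv_dir_deriv_eq using p
      by (intro sum_nonneg mult_nonneg_nonneg coord_deriv_nonneg hereditary_coord_deriv her) auto
    ultimately have "Q x x * Q p p \<le> (Q x p)\<^sup>2"
      unfolding Qeq
      by (intro reverse_cauchy_diff E_nonneg) (auto simp: power2_eq_square mult_ac)
    then show ?thesis by (simp add: Q_def w_def)
  qed
qed

section \<open>Weights of partial transversals\<close>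

definition fibre_dir :: "('a \<Rightarrow> 'b) \<Rightarrow> 'b \<Rightarrow> 'a option \<Rightarrow> real" where
  "fibre_dir \<pi> i k = (case k of None \<Rightarrow> 0 | Some a \<Rightarrow> if \<pi> a = i then 1 else 0)"

definition fibre_deriv :: "('a::finite \<Rightarrow> 'b) \<Rightarrow> 'b set \<Rightarrow> ('a set \<Rightarrow> real) \<Rightarrow> 'a set \<Rightarrow> real" where
  "fibre_deriv \<pi> T w = Finite_Set.fold (\<lambda>i. dir_deriv (fibre_dir \<pi> i)) w T"

text \<open>On polynomials this substitutes the variable of \<open>\<pi> a\<close> for that of
  \<open>a\<close> and then drops all monomials that are not square-free.\<close>

definition pushforward :: "('a::finite \<Rightarrow> 'b) \<Rightarrow> ('a set \<Rightarrow> real) \<Rightarrow> 'b set \<Rightarrow> real" where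
  "pushforward \<pi> w T = fibre_deriv \<pi> T w {}"

lemma comp_fun_commute_dir_deriv: "comp_fun_commute (\<lambda>i. dir_deriv (fibre_dir \<pi> i))"
  by unfold_locales (simp add: fun_eq_iff dir_deriv_commute)

lemma fibre_deriv_empty [simp]: "fibre_deriv \<pi> {} w = w"
  by (simp add: fibre_deriv_def)

lemma fibre_deriv_insert:
  assumes "finite T" "i \<notin> T"
  shows "fibre_deriv \<pi> (insert i T) w = dir_deriv (fibre_dir \<pi> i) (fibre_deriv \<pi> T w)"
    and "fibre_deriv \<pi> (insert i T) w = fibre_deriv \<pi> T (dir_deriv (fibre_dir \<pi> i) w)"
proof -
  interpret comp_fun_commute "\<lambda>i. dir_deriv (fibre_dir \<pi> i)" by (rule comp_fun_commute_dir_deriv)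
  show "fibre_deriv \<pi> (insert i T) w = dir_deriv (fibre_dir \<pi> i) (fibre_deriv \<pi> T w)"
    unfolding fibre_deriv_def using assms by (rule fold_insert)
  show "fibre_deriv \<pi> (insert i T) w = fibre_deriv \<pi> T (dir_deriv (fibre_dir \<pi> i) w)"
    unfolding fibre_deriv_def using assms by (rule fold_insert2)
qed

lemma fibre_dir_nonneg: "0 \<le> fibre_dir \<pi> i k"
  by (simp add: fibre_dir_def split: option.split)

lemma hereditary_fibre_deriv: "finite T \<Longrightarrow> hereditary w \<Longrightarrow> hereditary (fibre_deriv \<pi> T w)"
  by (induction T rule: finite_induct) (auto simp: fibre_deriv_insert(1) fibre_dir_nonneg intro: hereditary_dir_deriv)

lemma hyperbolic_fibre_deriv:
  "finite T \<Longrightarrow> hyperbolic w \<Longrightarrow> hereditary w \<Longrightarrow> hyperbolic (fibre_deriv \<pi> T w)"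
  by (induction T rule: finite_induct)
    (auto simp: fibre_deriv_insert(1) fibre_dir_nonneg intro: hyperbolic_dir_deriv hereditary_fibre_deriv)

lemma dir_deriv_fibre_dir: "dir_deriv (fibre_dir \<pi> i) w S = (\<Sum>a | \<pi> a = i. coord_deriv (Some a) w S)"
proof -
  have "dir_deriv (fibre_dir \<pi> i) w S = (\<Sum>a\<in>UNIV. if \<pi> a = i then coord_deriv (Some a) w S else 0)"
    unfolding dir_deriv_def sum_option_UNIV fibre_dir_def by (auto intro: sum.cong)
  also have "\<dots> = (\<Sum>a | \<pi> a = i. coord_deriv (Some a) w S)"
    using sum.inter_filter[of UNIV "\<lambda>a. coord_deriv (Some a) w S" "\<lambda>a. \<pi> a = i"] by simp
  finally show ?thesis .
qed

lemma hereditary_pushforward: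
  fixes \<pi> :: "'a::finite \<Rightarrow> 'b::finite"
  assumes "hereditary w" shows "hereditary (pushforward \<pi> w)"
  unfolding hereditary_def
proof (intro conjI allI impI)
  fix T
  have her: "hereditary (fibre_deriv \<pi> T w)" by (rule hereditary_fibre_deriv[OF _ assms]) simp
  then show "0 \<le> pushforward \<pi> w T" by (simp add: pushforward_def hereditary_def)
  fix i
  assume "pushforward \<pi> w T = 0"
  then have "fibre_deriv \<pi> T w {} = 0" by (simp add: pushforward_def)
  then have "dir_deriv (fibre_dir \<pi> i) (fibre_deriv \<pi> T w) {} = 0"
    by (simp add: dir_deriv_def coord_deriv_eq_0[OF her])
  then show "pushforward \<pi> w (insert i T) = 0"
    using \<open>pushforward \<pi> w T = 0\<close>
    by (cases "i \<in> T") (auto simp: pushforward_def fibre_deriv_insert(1) insert_absorb)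
qed

text \<open>At \<open>T\<close> the Hessian is that of \<open>W\<close>, pulled back along
  \<open>lift\<close>, except that its diagonal entries \<open>d i i\<close> are removed, as they
  belong to squares. These entries are nonnegative, so a semidefinite form is subtracted and
  \<open>reverse_cauchy_diff\<close> applies.\<close>

lemma hyperbolic_pushforward:
  fixes \<pi> :: "'a::finite \<Rightarrow> 'b::finite"
  assumes hyp: "hyperbolic w" and her: "hereditary w"
  shows "hyperbolic (pushforward \<pi> w)"
  unfolding hyperbolic_def
proof (intro allI impI)
  fix T and x p :: "'b option \<Rightarrow> real"
  assume p: "\<forall>i. 0 \<le> p i"
  define W where "W = fibre_deriv \<pi> T w"
  define g where "g = pushforward \<pi> w"
  define V where "V = fibre_dir \<pi>"
  \<comment> \<open>The lift is zero on the fibres over \<open>T\<close>, since derivatives of the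
    pushforward by elements of \<open>T\<close> vanish at \<open>T\<close>.\<close>
  define lift :: "('b option \<Rightarrow> real) \<Rightarrow> 'a option \<Rightarrow> real" where
    "lift = (\<lambda>x k. case k of None \<Rightarrow> x None | Some a \<Rightarrow> if \<pi> a \<in> T then 0 else x (Some (\<pi> a)))"
  define d where "d = (\<lambda>i j. dir_deriv (V i) (dir_deriv (V j) W) {})"
  define E where "E = (\<lambda>x z. \<Sum>i\<in>-T. x (Some i) * z (Some i) * d i i :: real)"
  define Q where "Q = (\<lambda>x z. dir_deriv (lift x) (dir_deriv (lift z) W) {})"
  have herW: "hereditary W" and hypW: "hyperbolic W"
    unfolding W_def using hyp her by (auto intro: hereditary_fibre_deriv hyperbolic_fibre_deriv)
  have herg: "hereditary g" unfolding g_def by (rule hereditary_pushforward[OF her])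
  have lift_None: "lift x None = x None" for x by (simp add: lift_def)
  have dir_deriv_lift: "dir_deriv (lift x) v = (\<lambda>S. x None * v S + (\<Sum>i\<in>-T. x (Some i) * dir_deriv (V i) v S))" for x v
  proof
    fix S
    have "(\<Sum>i\<in>-T. x (Some i) * dir_deriv (V i) v S)
        = (\<Sum>i\<in>-T. \<Sum>a\<in>UNIV. if \<pi> a = i then x (Some i) * coord_deriv (Some a) v S else 0)"
      unfolding V_def dir_deriv_fibre_dir sum_distrib_left
    proof (rule sum.cong[OF refl])
      fix i
      show "(\<Sum>a | \<pi> a = i. x (Some i) * coord_deriv (Some a) v S)
          = (\<Sum>a\<in>UNIV. if \<pi> a = i then x (Some i) * coord_deriv (Some a) v S else 0)"
        using sum.inter_filter[of UNIV "\<lambda>a. x (Some i) * coord_deriv (Some a) v S" "\<lambda>a. \<pi> a = i"] by simp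
    qed
    also have "\<dots> = (\<Sum>a\<in>UNIV. \<Sum>i\<in>-T. if \<pi> a = i then x (Some i) * coord_deriv (Some a) v S else 0)"
      by (rule sum.swap)
    also have "\<dots> = (\<Sum>a\<in>UNIV. lift x (Some a) * coord_deriv (Some a) v S)"
      by (intro sum.cong refl) (simp add: lift_def)
    finally show "dir_deriv (lift x) v S = x None * v S + (\<Sum>i\<in>-T. x (Some i) * dir_deriv (V i) v S)"
      using lift_None by (simp add: dir_deriv_def[of "lift x"] sum_option_UNIV)
  qed
  have g0: "g T = W {}" by (simp add: g_def pushforward_def W_def)
  have g1: "coord_deriv (Some i) g T = (if i \<in> T then 0 else dir_deriv (V i) W {})" for i
    by (simp add: coord_deriv_def g_def pushforward_def fibre_deriv_insert(1) W_def V_def)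
  have g2: "coord_deriv (Some i) (coord_deriv (Some j) g) T = (if i \<in> T \<or> j \<in> T \<or> i = j then 0 else d i j)" for i j
    by (auto simp: coord_deriv_def g_def pushforward_def fibre_deriv_insert(1) W_def V_def d_def dir_deriv_commute)
  have Qeq: "dir_deriv x (dir_deriv z g) T = Q x z - E x z" for x z
  proof -
    have "Q x z = x None * dir_deriv (lift z) W {} + (\<Sum>i\<in>-T. x (Some i) * dir_deriv (V i) (dir_deriv (lift z) W) {})"
      unfolding Q_def dir_deriv_lift[of x] ..
    also have "\<dots> = x None * dir_deriv (lift z) W {} + (\<Sum>i\<in>-T. x (Some i) * dir_deriv (lift z) (dir_deriv (V i) W) {})"
      by (simp add: dir_deriv_commute)
    also have "\<dots> = x None * z None * W {} + (\<Sum>j\<in>-T. x None * z (Some j) * dir_deriv (V j) W {})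
       + (\<Sum>i\<in>-T. x (Some i) * z None * dir_deriv (V i) W {})
       + (\<Sum>i\<in>-T. \<Sum>j\<in>-T. x (Some i) * z (Some j) * d j i)"
      unfolding dir_deriv_lift d_def by (simp add: sum_distrib_left sum.distrib algebra_simps)
    finally have Q: "Q x z = \<dots>" .
    have "dir_deriv x (dir_deriv z g) T = x None * z None * W {} + (\<Sum>j\<in>UNIV. x None * z (Some j) * coord_deriv (Some j) g T)
       + (\<Sum>i\<in>UNIV. x (Some i) * z None * coord_deriv (Some i) g T)
       + (\<Sum>i\<in>UNIV. \<Sum>j\<in>UNIV. x (Some i) * z (Some j) * coord_deriv (Some i) (coord_deriv (Some j) g) T)"
      unfolding dir_deriv_dir_deriv_eq sum_option_UNIV sum.distrib by (simp add: g0)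
    also have "(\<Sum>j\<in>UNIV. x None * z (Some j) * coord_deriv (Some j) g T) = (\<Sum>j\<in>-T. x None * z (Some j) * dir_deriv (V j) W {})"
      by (rule sum.mono_neutral_cong_right) (auto simp: g1)
    also have "(\<Sum>i\<in>UNIV. x (Some i) * z None * coord_deriv (Some i) g T) = (\<Sum>i\<in>-T. x (Some i) * z None * dir_deriv (V i) W {})"
      by (rule sum.mono_neutral_cong_right) (auto simp: g1)
    also have "(\<Sum>i\<in>UNIV. \<Sum>j\<in>UNIV. x (Some i) * z (Some j) * coord_deriv (Some i) (coord_deriv (Some j) g) T)
      = (\<Sum>i\<in>-T. \<Sum>j\<in>-T. if i = j then 0 else x (Some i) * z (Some j) * d j i)"
      by (rule sum.mono_neutral_cong_right)
        (auto simp: g2 d_def dir_deriv_commute intro!: sum.mono_neutral_cong_right)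
    also have "\<dots> = (\<Sum>i\<in>-T. \<Sum>j\<in>-T. x (Some i) * z (Some j) * d j i)
        - (\<Sum>i\<in>-T. \<Sum>j\<in>-T. if i = j then x (Some i) * z (Some j) * d j i else 0)"
      unfolding sum_subtractf[symmetric] by (intro sum.cong refl) auto
    also have "(\<Sum>i\<in>-T. \<Sum>j\<in>-T. if i = j then x (Some i) * z (Some j) * d j i else 0) = E x z"
      unfolding E_def by (intro sum.cong refl) simp
    finally show ?thesis using Q by simp
  qed
  have d_nonneg: "0 \<le> d i i" for i
    unfolding d_def V_def dir_deriv_dir_deriv_eq
    by (intro sum_nonneg mult_nonneg_nonneg fibre_dir_nonneg coord_deriv_nonneg hereditary_coord_deriv herW)
  have E_nonneg: "0 \<le> E x x" for x
    unfolding E_def by (intro sum_nonneg mult_nonneg_nonneg[OF _ d_nonneg]) auto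
  have "(E x p)\<^sup>2 \<le> E x x * E p p"
  proof (rule quadratic_nonneg_discriminant)
    fix t
    have "E (\<lambda>i. x i + t * p i) (\<lambda>i. x i + t * p i) = E x x + 2 * E x p * t + E p p * t\<^sup>2"
      by (simp add: E_def sum.distrib sum_distrib_left sum_distrib_right power2_eq_square algebra_simps)
    then show "0 \<le> E x x + 2 * E x p * t + E p p * t\<^sup>2" using E_nonneg by metis
  qed (rule E_nonneg)
  moreover have "0 \<le> dir_deriv p (dir_deriv p g) T"
    unfolding dir_deriv_dir_deriv_eq using p
    by (intro sum_nonneg mult_nonneg_nonneg coord_deriv_nonneg hereditary_coord_deriv herg) auto
  moreover have "Q x x * Q p p \<le> (Q x p)\<^sup>2"
  proof -
    have "\<forall>k. 0 \<le> lift p k" using p by (auto simp: lift_def split: option.splits)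
    then show ?thesis using hypW unfolding hyperbolic_def Q_def by blast
  qed
  ultimately show "dir_deriv x (dir_deriv x (pushforward \<pi> w)) T * dir_deriv p (dir_deriv p (pushforward \<pi> w)) T
      \<le> (dir_deriv x (dir_deriv p (pushforward \<pi> w)) T)\<^sup>2"
    unfolding g_def[symmetric] Qeq by (intro reverse_cauchy_diff E_nonneg) auto
qed

text \<open>A transversal of the fibres over \<open>insert i T\<close> splits uniquely into a
  transversal over \<open>T\<close> and one point of the fibre over \<open>i\<close>.\<close>

lemma pushforward_eq:
  fixes \<pi> :: "'a::finite \<Rightarrow> 'b"
  assumes "finite T"
  shows "pushforward \<pi> w T = (\<Sum>R | inj_on \<pi> R \<and> \<pi> ` R = T. w R)"
  using assms
proof (induction T arbitrary: w rule: finite_induct)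
  case empty
  have "{R :: 'a set. inj_on \<pi> R \<and> \<pi> ` R = {}} = {{}}" by auto
  then show ?case by (simp add: pushforward_def)
next
  case (insert i T)
  let ?Tr = "\<lambda>T. {R. inj_on \<pi> R \<and> \<pi> ` R = T}"
  have bij: "bij_betw (\<lambda>(R, a). insert a R) (?Tr T \<times> {a. \<pi> a = i}) (?Tr (insert i T))"
    unfolding bij_betw_def
  proof
    have avoid: "b \<in> R \<Longrightarrow> \<pi> b \<noteq> i" if "R \<in> ?Tr T" for R b
      using that insert.hyps by auto
    show "inj_on (\<lambda>(R, a). insert a R) (?Tr T \<times> {a. \<pi> a = i})"
    proof (rule inj_onI)
      fix x y assume xy: "x \<in> ?Tr T \<times> {a. \<pi> a = i}" "y \<in> ?Tr T \<times> {a. \<pi> a = i}"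
        and eq: "(case x of (R, a) \<Rightarrow> insert a R) = (case y of (R, a) \<Rightarrow> insert a R)"
      have rec: "fst z = (case z of (R, a) \<Rightarrow> insert a R) - {b. \<pi> b = i}"
        "{snd z} = (case z of (R, a) \<Rightarrow> insert a R) \<inter> {b. \<pi> b = i}"
        if "z \<in> ?Tr T \<times> {a. \<pi> a = i}" for z
        using that avoid[of "fst z"] by (cases z; auto)+
      have "fst x = fst y" using rec(1)[OF xy(1)] rec(1)[OF xy(2)] eq by simp
      moreover have "{snd x} = {snd y}" using rec(2)[OF xy(1)] rec(2)[OF xy(2)] eq by (simp only:)
      ultimately show "x = y" by (simp add: prod_eq_iff)
    qed
    show "(\<lambda>(R, a). insert a R) ` (?Tr T \<times> {a. \<pi> a = i}) = ?Tr (insert i T)"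
    proof (intro equalityI subsetI)
      fix R assume "R \<in> ?Tr (insert i T)"
      then have R: "inj_on \<pi> R" "\<pi> ` R = insert i T" by auto
      then obtain a where a: "a \<in> R" "\<pi> a = i" by (metis imageE insertI1)
      then have "\<pi> ` (R - {a}) = T"
        using R(2) a insert.hyps(2) inj_on_image_set_diff[OF R(1), of R "{a}"] by simp
      then have "R - {a} \<in> ?Tr T" using inj_on_subset[OF R(1), of "R - {a}"] by simp
      moreover have "R = insert a (R - {a})" using a(1) by blast
      ultimately show "R \<in> (\<lambda>(R, a). insert a R) ` (?Tr T \<times> {a. \<pi> a = i})"
        using a(2) by (intro image_eqI[of _ _ "(R - {a}, a)"]) auto
    next
      fix R assume "R \<in> (\<lambda>(R, a). insert a R) ` (?Tr T \<times> {a. \<pi> a = i})"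
      then obtain R' a where R': "R = insert a R'" "inj_on \<pi> R'" "\<pi> ` R' = T" "\<pi> a = i" by auto
      then have "inj_on \<pi> R"
        using insert.hyps(2) by simp blast
      then show "R \<in> ?Tr (insert i T)" using R' by simp
    qed
  qed
  \<comment> \<open>The derivative for \<open>i\<close> is applied first and changes the weight,
    hence the induction for arbitrary \<open>w\<close>.\<close>
  have "pushforward \<pi> w (insert i T) = pushforward \<pi> (dir_deriv (fibre_dir \<pi> i) w) T"
    using insert.hyps by (simp add: pushforward_def fibre_deriv_insert(2))
  also have "\<dots> = (\<Sum>R\<in>?Tr T. \<Sum>a | \<pi> a = i. coord_deriv (Some a) w R)"
    unfolding insert.IH dir_deriv_fibre_dir ..
  also have "\<dots> = (\<Sum>R\<in>?Tr T. \<Sum>a | \<pi> a = i. w (insert a R))"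
  proof (intro sum.cong refl)
    fix R a assume "R \<in> ?Tr T" "a \<in> {a. \<pi> a = i}"
    then have "a \<notin> R" using insert.hyps by auto
    then show "coord_deriv (Some a) w R = w (insert a R)" by (simp add: coord_deriv_def)
  qed
  also have "\<dots> = (\<Sum>(R, a)\<in>?Tr T \<times> {a. \<pi> a = i}. w (insert a R))"
    by (simp add: sum.cartesian_product)
  also have "\<dots> = (\<Sum>R\<in>?Tr (insert i T). w R)"
    using sum.reindex_bij_betw[OF bij, of w] by (simp add: case_prod_beta')
  finally show ?case .
qed

lemma sum_pushforward:
  fixes \<pi> :: "'a::finite \<Rightarrow> 'b::finite"
  shows "(\<Sum>T | card T = k. pushforward \<pi> w T) = (\<Sum>R | inj_on \<pi> R \<and> card R = k. w R)"
proof -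
  have "(\<Sum>R | inj_on \<pi> R \<and> card R = k. w R)
      = (\<Sum>T | card T = k. \<Sum>R | R \<in> {R. inj_on \<pi> R \<and> card R = k} \<and> \<pi> ` R = T. w R)"
    by (rule sum.group[symmetric]) (auto simp: card_image)
  also have "\<dots> = (\<Sum>T | card T = k. pushforward \<pi> w T)"
    by (intro sum.cong refl) (auto simp: pushforward_eq card_image intro!: sum.cong)
  finally show ?thesis ..
qed

section \<open>Ultra log-concavity of the level sums\<close>

definition ones_dir :: "'a option \<Rightarrow> real" where
  "ones_dir k = (case k of None \<Rightarrow> 0 | Some a \<Rightarrow> 1)"

text \<open>A set of size \<open>k\<close> is built up from the empty set in \<open>fact k\<close>
  orders; the induction counts pairs of a set and its last element.\<close>

lemma funpow_dir_deriv_ones: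
  "((dir_deriv ones_dir) ^^ k) w {} = fact k * (\<Sum>T | card T = k. w (T :: 'a::finite set))"
proof (induction k arbitrary: w)
  case 0
  have "{T :: 'a set. card T = 0} = {{}}" by auto
  then show ?case by simp
next
  case (Suc k)
  have "((dir_deriv ones_dir) ^^ Suc k) w {} = fact k * (\<Sum>T | card T = k. dir_deriv ones_dir w T)"
    by (subst funpow_Suc_right) (simp add: Suc)
  also have "(\<Sum>T | card T = k. dir_deriv ones_dir w T) = (\<Sum>T | card T = k. \<Sum>a\<in>-T. w (insert a T))"
  proof (intro sum.cong refl)
    fix T :: "'a set"
    show "dir_deriv ones_dir w T = (\<Sum>a\<in>-T. w (insert a T))"
      unfolding dir_deriv_def sum_option_UNIV ones_dir_def
      by (simp, rule sum.mono_neutral_cong_right) (auto simp: coord_deriv_def)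
  qed
  also have "\<dots> = (\<Sum>(T, a)\<in>(SIGMA T:{T. card T = k}. -T). w (insert a T))"
    by (rule sum.Sigma) auto
  also have "\<dots> = (\<Sum>(T, a)\<in>(SIGMA T:{T. card T = Suc k}. T). w T)"
    by (rule sum.reindex_bij_witness[where i = "\<lambda>(T, a). (T - {a}, a)" and j = "\<lambda>(T, a). (insert a T, a)"])
      (auto simp: insert_absorb)
  also have "\<dots> = (\<Sum>T | card T = Suc k. \<Sum>a\<in>T. w T)"
    by (rule sum.Sigma[symmetric]) auto
  also have "\<dots> = Suc k * (\<Sum>T | card T = Suc k. w T)"
    by (simp add: sum_distrib_left)
  finally show ?case by simp
qed

text \<open>After \<open>k - 1\<close> derivatives in the direction \<open>ones_dir\<close>, reverse
  Cauchy-Schwarz is applied to the directions \<open>e\<close> and \<open>ones_dir\<close>. As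
  \<open>e\<close> fixes every weight, the three values of the form are \<open>c (k - 1)\<close>,
  \<open>c k\<close> and \<open>c (k + 1)\<close>.\<close>

lemma hyperbolic_ultra_log_concave:
  fixes w :: "'a::finite set \<Rightarrow> real"
  assumes "hyperbolic w" "hereditary w" "1 \<le> k"
  defines "c \<equiv> \<lambda>j. fact j * (\<Sum>T | card T = j. w T)"
  shows "c (k - 1) * c (k + 1) \<le> (c k)\<^sup>2"
proof -
  define v where "v = ((dir_deriv ones_dir) ^^ (k - 1)) w"
  have ones: "0 \<le> ones_dir i" for i :: "'a option" by (simp add: ones_dir_def split: option.split)
  have "hyperbolic (((dir_deriv ones_dir) ^^ j) w) \<and> hereditary (((dir_deriv ones_dir) ^^ j) w)" for j
    by (induction j) (auto intro: assms(1,2) hyperbolic_dir_deriv hereditary_dir_deriv ones)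
  then have hyp: "hyperbolic v" by (simp add: v_def)
  define e :: "'a option \<Rightarrow> real" where "e = (\<lambda>i. if i = None then 1 else 0)"
  have e: "dir_deriv e f = f" for f
    by (rule ext) (simp add: dir_deriv_def sum_option_UNIV e_def)
  have "dir_deriv e (dir_deriv e v) {} * dir_deriv ones_dir (dir_deriv ones_dir v) {} \<le> (dir_deriv e (dir_deriv ones_dir v) {})\<^sup>2"
    using hyp ones unfolding hyperbolic_def by blast
  then have "v {} * dir_deriv ones_dir (dir_deriv ones_dir v) {} \<le> (dir_deriv ones_dir v {})\<^sup>2" by (simp add: e)
  moreover have "v {} = c (k - 1)" by (simp add: v_def c_def funpow_dir_deriv_ones)
  moreover have "dir_deriv ones_dir v = ((dir_deriv ones_dir) ^^ k) w"
    using assms(3) by (cases k) (auto simp: v_def)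
  ultimately show ?thesis using funpow_dir_deriv_ones[of "Suc k" w] funpow_dir_deriv_ones[of k w]
    by (simp add: c_def)
qed

section \<open>Delta-matroids\<close>

lemma bar_bar [simp]: "bar (bar a) = a" and bar_neq [simp]: "bar a \<noteq> a" "a \<noteq> bar a"
  and fst_bar [simp]: "fst (bar a) = fst a"
  by (auto simp: bar_def prod_eq_iff)

lemma fst_eq_iff_bar: "fst a = fst b \<longleftrightarrow> a = b \<or> a = bar b"
  by (cases a; cases b) (auto simp: bar_def)

text \<open>This makes admissible sets the partial transversals of the fibres of \<open>fst\<close>,
  so that \<open>pushforward fst\<close> sums over them.\<close>

lemma admissible_iff_inj_on: "admissible S \<longleftrightarrow> inj_on fst S"
  unfolding admissible_def inj_on_def fst_eq_iff_bar by fastforce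

lemma card_admissible_le: "admissible S \<Longrightarrow> card S \<le> CARD('n)" for S :: "('n::finite \<times> bool) set"
  using card_mono[of UNIV "fst ` S"] by (simp add: admissible_iff_inj_on card_image)

lemma full_admissible_iff:
  fixes B :: "('n::finite \<times> bool) set"
  assumes "admissible B" "card B = CARD('n)"
  shows "bar a \<in> B \<longleftrightarrow> a \<notin> B"
proof
  show "a \<notin> B" if "bar a \<in> B" using that assms(1) by (auto simp: admissible_def)
  assume "a \<notin> B"
  have "fst ` B = UNIV"
    using assms by (intro card_subset_eq) (auto simp: admissible_iff_inj_on card_image)
  then obtain b where "b \<in> B" "fst b = fst a" by (metis UNIV_I imageE)
  then show "bar a \<in> B" using \<open>a \<notin> B\<close> by (auto simp: fst_eq_iff_bar)
qed

lemma card_bar_set_Int: "card (bar_set S \<inter> B) = card {a \<in> S. bar a \<in> B}"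
proof -
  have "bar_set S \<inter> B = bar ` {a \<in> S. bar a \<in> B}" by (auto simp: bar_set_def)
  moreover have "inj_on bar {a \<in> S. bar a \<in> B}" by (metis bar_bar inj_onI)
  ultimately show ?thesis by (simp add: card_image)
qed

lemma evec_inner: "evec (a :: 'n::finite \<times> bool) \<bullet> x = (if snd a then - x $ fst a else x $ fst a)"
  by (simp add: evec_def inner_axis')

lemma env_ind_vec: "env (ind_vec S) = eset S"
proof (rule vec_eq_iff[THEN iffD2], rule allI)
  fix i
  have "eset S $ i = (\<Sum>a\<in>S. evec a $ i)"
    by (simp add: eset_def)
  also have "\<dots> = (\<Sum>a\<in>S. (if a = (i, False) then 1 else 0) - (if a = (i, True) then 1 else 0))"
    by (intro sum.cong refl) (auto simp: evec_def axis_def)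
  also have "\<dots> = env (ind_vec S) $ i"
    by (simp add: sum_subtractf env_def ind_vec_def)
  finally show "env (ind_vec S) $ i = eset S $ i" by simp
qed

lemma evec_eset: "evec a \<bullet> eset C = (if a \<in> C then 1 else 0) - (if bar a \<in> C then 1 else 0)"
  by (cases a) (auto simp: evec_inner env_ind_vec[symmetric] env_def ind_vec_def bar_def)

lemma eset_inner: "eset S \<bullet> eset C = real (card (S \<inter> C)) - real (card (bar_set S \<inter> C))"
proof -
  have "eset S \<bullet> eset C = (\<Sum>a\<in>S. (if a \<in> C then 1 else 0) - (if bar a \<in> C then 1 else 0))"
    unfolding eset_def[of S] inner_sum_left evec_eset ..
  also have "\<dots> = real (card (S \<inter> C)) - real (card {a \<in> S. bar a \<in> C})"
    by (simp add: sum_subtractf sum.If_cases Int_def)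
  finally show ?thesis by (simp add: card_bar_set_Int)
qed

text \<open>The equality of polytopes enters through this bound: it moves an estimate for a linear
  functional between feasible sets and bases.\<close>

lemma inner_le_convex_hull:
  fixes s :: "'v::real_inner"
  assumes "p \<in> convex hull A"
  obtains q where "q \<in> A" "s \<bullet> p \<le> s \<bullet> q"
proof (rule ccontr)
  assume "\<not> thesis"
  then have "A \<subseteq> {y. s \<bullet> y < s \<bullet> p}" using that by force
  then have "convex hull A \<subseteq> {y. s \<bullet> y < s \<bullet> p}" by (intro hull_minimal convex_halfspace_lt)
  then show False using assms by auto
qed

lemma enveloping_convex_hull_eq:
  fixes F :: "('n::finite \<times> bool) set set"
  assumes "enveloping_matroid F \<B>"
  shows "convex hull (eset ` \<B>) = convex hull (eset ` F)"
proof -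
  have "linear (env :: real ^ ('n \<times> bool) \<Rightarrow> real ^ 'n)" by (rule linearI) (auto simp: env_def vec_eq_iff algebra_simps)
  then have "env ` matroid_polytope \<B> = convex hull (env ` ind_vec ` \<B>)"
    unfolding matroid_polytope_def by (rule convex_hull_linear_image)
  then show ?thesis
    using assms by (simp add: enveloping_matroid_def dm_polytope_def image_image env_ind_vec)
qed

text \<open>The functional \<open>eset B\<close> has the value \<open>card B\<close> at
  \<open>eset B\<close>. A basis reaching this value must contain \<open>B\<close> and avoid
  \<open>bar_set B\<close>, and so equals \<open>B\<close>.\<close>

lemma feasible_in_bases:
  fixes F :: "('n::finite \<times> bool) set set"
  assumes "delta_matroid F" "enveloping_matroid F \<B>" "B \<in> F"
  shows "B \<in> \<B>"
proof -
  have B: "admissible B" "card B = CARD('n)" using assms by (auto simp: delta_matroid_def)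
  have "eset B \<in> convex hull (eset ` \<B>)"
    unfolding enveloping_convex_hull_eq[OF assms(2)] using assms(3) by (intro hull_inc) auto
  then obtain C where C: "C \<in> \<B>" "eset B \<bullet> eset B \<le> eset B \<bullet> eset C"
    by (auto elim: inner_le_convex_hull)
  have "bar_set B \<inter> B = {}" using B(1) by (auto simp: bar_set_def admissible_def)
  then have "real (card B) \<le> real (card (B \<inter> C)) - real (card (bar_set B \<inter> C))"
    using C(2) by (simp add: eset_inner)
  moreover have "card (B \<inter> C) \<le> card B" by (rule card_mono) auto
  ultimately have "card (B \<inter> C) = card B" "card (bar_set B \<inter> C) = 0" by linarith+
  then have "B \<inter> C = B" and empty: "bar_set B \<inter> C = {}"
    using card_subset_eq[of B "B \<inter> C"] by auto
  moreover have "C \<subseteq> B"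
  proof
    fix a assume "a \<in> C"
    then have "a \<notin> bar_set B" using empty by blast
    then show "a \<in> B" using full_admissible_iff[OF B, of a] unfolding bar_set_def
      by (metis bar_bar imageI)
  qed
  ultimately have "B = C" by blast
  then show ?thesis using C by simp
qed

lemma card_Int_bar_set_Int:
  fixes B :: "('n::finite \<times> bool) set"
  assumes "admissible B" "card B = CARD('n)"
  shows "card (S \<inter> B) + card (bar_set S \<inter> B) = card S"
proof -
  have "card S = card ({a \<in> S. a \<in> B} \<union> {a \<in> S. bar a \<in> B})"
    using full_admissible_iff[OF assms] by (auto intro: arg_cong[of _ _ card])
  also have "\<dots> = card {a \<in> S. a \<in> B} + card {a \<in> S. bar a \<in> B}"
    using full_admissible_iff[OF assms] by (intro card_Un_disjoint) auto
  finally show ?thesis unfolding card_bar_set_Int by (simp add: Int_def)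
qed

text \<open>The rank of \<open>S\<close> in \<open>F\<close> has the parity of \<open>card S\<close>, so it is full as soon as it is at
  least \<open>card S - 1\<close>.\<close>

lemma indep_feasible_iff:
  fixes F :: "('n::finite \<times> bool) set set"
  assumes dm: "delta_matroid F" and env: "enveloping_matroid F \<B>" and "admissible S"
  shows "indep F S \<longleftrightarrow> indep \<B> S"
proof
  show "indep \<B> S" if "indep F S"
    using that feasible_in_bases[OF dm env] by (auto simp: indep_def)
  have m: "matroid_bases \<B>" using env by (simp add: enveloping_matroid_def)
  have "finite S" by simp
  then show "indep F S" if "indep \<B> S"
    using that \<open>admissible S\<close>
  proof (induction S rule: finite_induct)
    case empty
    then show ?case using dm by (auto simp: indep_def delta_matroid_def)
  next
    case (insert a S)
    have "indep \<B> S" "admissible S" using insert.prems by (auto simp: indep_def admissible_def)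
    then obtain B where B: "B \<in> F" "S \<subseteq> B" using insert.IH by (auto simp: indep_def)
    have Bf: "admissible B" "card B = CARD('n)" if "B \<in> F" for B using dm that by (auto simp: delta_matroid_def)
    obtain C where C: "C \<in> \<B>" "insert a S \<subseteq> C" "C \<subseteq> insert a S \<union> B"
      using indep_extend[OF m insert.prems(1) feasible_in_bases[OF dm env B(1)]] .
    \<comment> \<open>Because \<open>C\<close> lies in \<open>insert a S \<union> B\<close> and
      \<open>S\<close> in the admissible set \<open>B\<close>, the only conjugate of an element of
      \<open>insert a S\<close> that \<open>C\<close> can contain is \<open>bar a\<close>. The value
      of \<open>eset (insert a S)\<close> at \<open>eset C\<close> thus falls short of its maximum
      by at most 1.\<close>
    have "b = a" if "b \<in> insert a S" "bar b \<in> C" for b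
      using that insert.prems(2) B(2) C(3) Bf(1)[OF B(1)] unfolding admissible_def by blast
    then have "{b \<in> insert a S. bar b \<in> C} \<subseteq> {a}" by blast
    then have "card (bar_set (insert a S) \<inter> C) \<le> 1"
      unfolding card_bar_set_Int using card_mono[of "{a}"] by fastforce
    moreover have "insert a S \<inter> C = insert a S" using C(2) by blast
    ultimately have "real (card (insert a S)) - 1 \<le> eset (insert a S) \<bullet> eset C"
      unfolding eset_inner by simp
    moreover have "eset C \<in> convex hull (eset ` F)"
      unfolding enveloping_convex_hull_eq[OF env, symmetric] using C(1) by (intro hull_inc) auto
    then obtain A where A: "A \<in> F" "eset (insert a S) \<bullet> eset C \<le> eset (insert a S) \<bullet> eset A"
      by (auto elim: inner_le_convex_hull)
    ultimately have "real (card (insert a S)) - 1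
        \<le> real (card (insert a S \<inter> A)) - real (card (bar_set (insert a S) \<inter> A))"
      unfolding eset_inner by linarith
    then have "card (bar_set (insert a S) \<inter> A) = 0"
      using card_Int_bar_set_Int[OF Bf[OF A(1)], of "insert a S"] by linarith
    then have "card (insert a S \<inter> A) = card (insert a S)"
      using card_Int_bar_set_Int[OF Bf[OF A(1)], of "insert a S"] by simp
    then have "insert a S \<inter> A = insert a S" by (intro card_subset_eq) auto
    then show ?case using A(1) by (auto simp: indep_def)
  qed
qed

section \<open>The coefficients of the U-polynomial at v = 0\<close>

lemma zero_power_rank_deficit:
  fixes F :: "('n::finite \<times> bool) set set"
  assumes "delta_matroid F"
  shows "(0::real) ^ nat ((int (card S) - dm_rank F S) div 2) = (if indep F S then 1 else 0)"
proof -
  define v where "v = (\<lambda>B. int (card (S \<inter> B)) - int (card (bar_set S \<inter> B)))"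
  have rank: "dm_rank F S = Max (v ` F)" by (simp add: dm_rank_def v_def)
  have F: "F \<noteq> {}" "\<And>B. B \<in> F \<Longrightarrow> card (S \<inter> B) + card (bar_set S \<inter> B) = card S"
    using assms card_Int_bar_set_Int by (auto simp: delta_matroid_def)
  show ?thesis
  proof (cases "indep F S")
    case True
    then obtain B where B: "B \<in> F" "S \<subseteq> B" by (auto simp: indep_def)
    then have "S \<inter> B = S" by blast
    then have "v B = int (card S)" using F(2)[OF B(1)] by (simp add: v_def)
    moreover have "v B \<le> dm_rank F S" unfolding rank using B(1) by (intro Max_ge) auto
    \<comment> \<open>The exponent is 0 here, and \<open>0 ^ 0 = 1\<close>.\<close>
    ultimately show ?thesis using True by simp
  next
    case False
    \<comment> \<open>An element of \<open>S\<close> missing from \<open>B\<close> costs 2, as its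
      conjugate lies in \<open>B\<close>; after halving, the exponent is still at least 1.\<close>
    have "v B \<le> int (card S) - 2" if "B \<in> F" for B
    proof -
      have "card (S \<inter> B) \<noteq> card S"
      proof
        assume "card (S \<inter> B) = card S"
        then have "S \<inter> B = S" by (intro card_subset_eq) auto
        then show False using False that by (auto simp: indep_def)
      qed
      then show ?thesis using F(2)[OF that] unfolding v_def by linarith
    qed
    then have "dm_rank F S \<le> int (card S) - 2" unfolding rank using F(1) by (subst Max_le_iff) auto
    then have "nat ((int (card S) - dm_rank F S) div 2) \<noteq> 0" by linarith
    then show ?thesis using False by simp
  qed
qed

lemma U_poly_at_zero:
  fixes F :: "('n::finite \<times> bool) set set"
  assumes "delta_matroid F"
  shows "U_poly F u 0 = (\<Sum>j\<le>CARD('n). real (card {S. admissible S \<and> indep F S \<and> card S = j}) * u ^ (CARD('n) - j))"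
proof -
  have "U_poly F u 0 = (\<Sum>S\<in>AdS. if indep F S then u ^ (CARD('n) - card S) else 0)"
    unfolding U_poly_def zero_power_rank_deficit[OF assms] by (intro sum.cong refl) simp
  also have "\<dots> = (\<Sum>S | S \<in> AdS \<and> indep F S. u ^ (CARD('n) - card S))"
    by (rule sum.inter_filter[symmetric]) simp
  also have "\<dots> = (\<Sum>j\<le>CARD('n). \<Sum>S | S \<in> {S. S \<in> AdS \<and> indep F S} \<and> card S = j. u ^ (CARD('n) - card S))"
    by (rule sum.group[symmetric]) (auto simp: AdS_def card_admissible_le)
  also have "\<dots> = (\<Sum>j\<le>CARD('n). real (card {S. admissible S \<and> indep F S \<and> card S = j}) * u ^ (CARD('n) - j))"
    by (intro sum.cong refl) (simp add: AdS_def)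
  finally show ?thesis .
qed

lemma coeffs_eq_of_reversed_sums_eq:
  fixes a b :: "nat \<Rightarrow> real"
  assumes "\<forall>u. (\<Sum>j\<le>n. a j * u ^ (n - j)) = (\<Sum>j\<le>n. b j * u ^ (n - j))" and "j \<le> n"
  shows "a j = b j"
proof -
  have rev: "(\<Sum>j\<le>n. c j * u ^ (n - j)) = (\<Sum>i\<le>n. c (n - i) * u ^ i)" for c :: "nat \<Rightarrow> real" and u
    by (rule sum.reindex_bij_witness[where i = "\<lambda>i. n - i" and j = "\<lambda>i. n - i"]) auto
  have "\<forall>i\<le>n. a (n - i) = b (n - i)"
    using assms(1) unfolding rev polyfun_eq_coeffs .
  from this[rule_format, of "n - j"] show ?thesis using assms(2) by simp
qed

theorem theorem1p6:
  fixes F :: "('n::finite \<times> bool) set set" and a :: "nat \<Rightarrow> real" and k :: nat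
  assumes "delta_matroid F"
    and "\<exists>\<B>. enveloping_matroid F \<B>"
    and "\<forall>u. U_poly F u 0 = (\<Sum>j\<le>CARD('n). a j * u ^ (CARD('n) - j))"
    and "1 \<le> k" and "k \<le> CARD('n) - 1"
  shows "(a k)\<^sup>2 \<ge> (real (2 * CARD('n) - k + 1) / real (2 * CARD('n) - k)) *
                    (real (k + 1) / real k) * a (k + 1) * a (k - 1)"
proof -
  obtain \<B> where env: "enveloping_matroid F \<B>" using assms(2) by blast
  then have m: "matroid_bases \<B>" by (simp add: enveloping_matroid_def)
  define N where "N = 2 * CARD('n)"
  define w where "w = mason_weight N \<B>"
  have card_basis: "card B = CARD('n)" if "B \<in> \<B>" for B
  proof -
    obtain C where C: "C \<in> F" using assms(1) by (auto simp: delta_matroid_def)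
    then have "card C = CARD('n)" using assms(1) by (simp add: delta_matroid_def)
    then show ?thesis
      using card_bases_eq[OF m that feasible_in_bases[OF assms(1) env C]] by simp
  qed
  \<comment> \<open>The bounds on \<open>k\<close> force \<open>CARD('n) \<ge> 2\<close>, so bases
    of size \<open>CARD('n)\<close> satisfy \<open>card B + 2 \<le> N\<close>.\<close>
  have hyp: "hyperbolic w" unfolding w_def
    by (rule hyperbolic_mason_weight[OF m]) (use assms(4,5) card_basis in \<open>auto simp: N_def\<close>)
  have her: "hereditary w" unfolding w_def by (rule hereditary_mason_weight)
  define g where "g = pushforward fst w"
  define c where "c = (\<lambda>j. fact j * (\<Sum>T | card T = j. g T))"
  have lc: "c (k - 1) * c (k + 1) \<le> (c k)\<^sup>2"
    unfolding c_def g_def using assms(4)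
    by (intro hyperbolic_ultra_log_concave hyperbolic_pushforward hereditary_pushforward hyp her)
  have a: "a j = real (card {S. admissible S \<and> indep F S \<and> card S = j})" if "j \<le> CARD('n)" for j
    using assms(3) that unfolding U_poly_at_zero[OF assms(1)]
    by (intro coeffs_eq_of_reversed_sums_eq[where n = "CARD('n)" and a = a]) auto
  \<comment> \<open>Up to the constant factor \<open>fact N\<close> this is \<open>a j\<close>
    divided by the binomial coefficient of \<open>N\<close> over \<open>j\<close>, so log-concavity
    of \<open>c\<close> is ultra log-concavity of \<open>a\<close> of order
    \<open>N\<close>.\<close>
  have c: "c j = fact j * fact (N - j) * a j" if "j \<le> CARD('n)" for j
  proof -
    have "(\<Sum>T | card T = j. g T) = (\<Sum>R | inj_on fst R \<and> card R = j. w R)"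
      unfolding g_def by (rule sum_pushforward)
    also have "\<dots> = (\<Sum>R | R \<in> {R. inj_on fst R \<and> card R = j} \<and> indep \<B> R. fact (N - j))"
      unfolding w_def mason_weight_def by (subst sum.inter_filter) (auto intro!: sum.cong)
    also have "{R. R \<in> {R. inj_on fst R \<and> card R = j} \<and> indep \<B> R} = {S. admissible S \<and> indep F S \<and> card S = j}"
      using indep_feasible_iff[OF assms(1) env] by (auto simp: admissible_iff_inj_on)
    finally show ?thesis using a[OF that] by (simp add: c_def)
  qed
  define M where "M = N - k"
  obtain l where l: "k = Suc l" using assms(4) by (cases k) auto
  have "M \<ge> 1" using assms(5) l by (simp add: M_def N_def)
  then obtain r where r: "M = Suc r" by (cases M) auto
  have "N - (k - 1) = Suc M" "N - (k + 1) = r" "N - k = M"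
    using l r by (auto simp: M_def)
  then have "(fact l * fact (Suc M) * a (k - 1)) * (fact (Suc k) * fact r * a (k + 1)) \<le> (fact k * fact M * a k)\<^sup>2"
    using lc c[of "k - 1"] c[of k] c[of "k + 1"] assms(5) l by simp
  moreover have "(fact l * fact (Suc M) * a (k - 1)) * (fact (Suc k) * fact r * a (k + 1))
      = (fact k * fact M)\<^sup>2 * ((M + 1) / M * ((k + 1) / k) * a (k + 1) * a (k - 1))"
  proof -
    have M: "fact (Suc M) = (real M + 1) * fact M" "fact M = real M * fact r"
      and k: "fact (Suc k) = (real k + 1) * fact k" "fact k = real k * fact l"
      by (simp_all add: l r algebra_simps)
    \<comment> \<open>Here \<open>p\<close> and \<open>q\<close> stand for \<open>fact l\<close> and
      \<open>fact r\<close>, and \<open>x\<close> and \<open>y\<close> for \<open>k\<close> and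
      \<open>M\<close>; once the factorials are expanded, the identity is purely rational.\<close>
    have "p * ((y + 1) * (y * q)) * s * ((x + 1) * (x * p) * q * t)
        = (x * p * (y * q))\<^sup>2 * ((y + 1) / y * ((x + 1) / x) * t * s)"
      if "x \<noteq> 0" "y \<noteq> 0" for p q s t x y :: real
      using that by (simp add: power2_eq_square field_simps)
    from this[of "real k" "real M"] show ?thesis unfolding M k using l r by simp
  qed
  ultimately have "(fact k * fact M)\<^sup>2 * ((M + 1) / M * ((k + 1) / k) * a (k + 1) * a (k - 1))
      \<le> (fact k * fact M)\<^sup>2 * (a k)\<^sup>2"
    by (simp add: power_mult_distrib)
  then have "(M + 1) / M * ((k + 1) / k) * a (k + 1) * a (k - 1) \<le> (a k)\<^sup>2"
    by (subst (asm) mult_le_cancel_left_pos) auto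
  then show ?thesis by (simp add: M_def N_def add.commute)
qed

end
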